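(* Let $G$ be a finite simple gap free graph with edge ideal $I$ and $3$-path ideal $I_3$. If $I_3\neq 0$ and $\operatorname{reg}(I)=r$, then $\operatorname{reg}(I_3)\leq \max\{r,3\}$.
   Context: Let $K$ be a field and $S$ the polynomial ring over $K$ whose variables are the vertices of $G$. The edge ideal $I\subseteq S$ is generated by the monomials $xy$ with $xy$ an edge of $G$. The $3$-path ideal $I_3\subseteq S$ is generated by the monomials $abc$ with $a,b,c$ distinct vertices and $ab$, $bc$ edges of $G$. $G$ is gap free if there are no two vertex-disjoint edges $uv$, $xy$ of $G$ such that $G$ has no edge with one endpoint in $\{u,v\}$ and the other in $\{x,y\}$ (equivalently, the complement $G^c$ has no induced $4$-cycle). For a finitely generated graded $S$-module $M$, $\operatorname{reg}(M)=\max\{j-i : \operatorname{Tor}_i^S(M,K)_j\neq 0\}$ is the Castelnuovo-Mumford regularity. *)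

theory Defs
  imports HOL.Modules "HOL-Library.Poly_Mapping"
begin

section \<open>Polynomial rings and ideals\<close>

text \<open>Exponent vectors are finitely supported maps \<open>'v \<Rightarrow>\<^sub>0 nat\<close>; the polynomial
  ring over \<open>'k\<close> with variables the elements of \<open>'v\<close> consists of the finitely supported maps from
  exponent vectors to coefficients, with the convolution product of the library.\<close>

type_synonym ('v, 'k) mpoly = "('v \<Rightarrow>\<^sub>0 nat) \<Rightarrow>\<^sub>0 'k"

definition Var :: "'v \<Rightarrow> ('v, 'k::comm_ring_1) mpoly" where
  "Var v = Poly_Mapping.single (Poly_Mapping.single v 1) 1"

definition total_deg :: "('v \<Rightarrow>\<^sub>0 nat) \<Rightarrow> nat" where
  "total_deg m = (\<Sum>v\<in>Poly_Mapping.keys m. Poly_Mapping.lookup m v)"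

text \<open>The zero polynomial is homogeneous of every degree; for \<open>d < 0\<close> it is the only one.\<close>

definition homogeneous :: "int \<Rightarrow> ('v, 'k::comm_ring_1) mpoly \<Rightarrow> bool" where
  "homogeneous d p \<longleftrightarrow> (\<forall>m\<in>Poly_Mapping.keys p. int (total_deg m) = d)"

text \<open>An ideal is a submodule of the ring acting on itself by multiplication.\<close>

lemma module_times: "module ((*) :: 'a::comm_ring_1 \<Rightarrow> 'a \<Rightarrow> 'a)"
  by unfold_locales (simp_all add: algebra_simps)

definition ideal_gen :: "'a::comm_ring_1 set \<Rightarrow> 'a set" where
  "ideal_gen B = module.span (*) B"


section \<open>Graded free resolutions, Tor and regularity\<close>

text \<open>Data of a complex of finitely generated graded free modules over the polynomial ring \<open>S\<close>
    \[ \cdots \to F_2 \to F_1 \to F_0 \to S, \qquad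
       F_i = \bigoplus_{b < \mathrm{rk}\,i} S(-\mathrm{shift}\,i\,b), \]
  so \<open>shift i b\<close> is the degree of the basis element \<open>e b\<close> of \<open>F i\<close>. The differential
  \<open>F (i + 1) \<rightarrow> F i\<close> sends \<open>e b\<close> to the sum of the \<open>dif i b c \<cdot> e c\<close>, and the augmentation
  \<open>F 0 \<rightarrow> S\<close> sends \<open>e b\<close> to \<open>aug b\<close>. Values at indices \<open>\<ge> rk\<close> are irrelevant.\<close>

record (overloaded) ('v, 'k) free_complex =
  rk :: "nat \<Rightarrow> nat"
  shift :: "nat \<Rightarrow> nat \<Rightarrow> int"
  dif :: "nat \<Rightarrow> nat \<Rightarrow> nat \<Rightarrow> ('v, 'k) mpoly"
  aug :: "nat \<Rightarrow> ('v, 'k) mpoly"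

definition free_mod :: "('v, 'k::field) free_complex \<Rightarrow> nat \<Rightarrow> (nat \<Rightarrow> ('v, 'k) mpoly) set" where
  "free_mod F i = {x. \<forall>b\<ge>rk F i. x b = 0}"

definition differential ::
    "('v, 'k::field) free_complex \<Rightarrow> nat \<Rightarrow> (nat \<Rightarrow> ('v, 'k) mpoly) \<Rightarrow> nat \<Rightarrow> ('v, 'k) mpoly" where
  "differential F i x =
     (\<lambda>c. if c < rk F i then \<Sum>b<rk F (Suc i). x b * dif F i b c else 0)"

definition augmentation ::
    "('v, 'k::field) free_complex \<Rightarrow> (nat \<Rightarrow> ('v, 'k) mpoly) \<Rightarrow> ('v, 'k) mpoly" where
  "augmentation F x = (\<Sum>b<rk F 0. x b * aug F b)"

text \<open>\<open>F\<close> is a graded free resolution of the homogeneous ideal \<open>M\<close>, viewed as a graded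
  \<open>S\<close>-module: all maps preserve degrees, and
  \<open>\<cdots> \<rightarrow> F 2 \<rightarrow> F 1 \<rightarrow> F 0 \<rightarrow> M \<rightarrow> 0\<close> is exact.\<close>

definition graded_free_resolution ::
    "('v, 'k::field) free_complex \<Rightarrow> ('v, 'k) mpoly set \<Rightarrow> bool" where
  "graded_free_resolution F M \<longleftrightarrow>
     (\<forall>b<rk F 0. homogeneous (shift F 0 b) (aug F b)) \<and>
     (\<forall>i. \<forall>b<rk F (Suc i). \<forall>c<rk F i.
        homogeneous (shift F (Suc i) b - shift F i c) (dif F i b c)) \<and>
     augmentation F ` free_mod F 0 = M \<and>
     {x \<in> free_mod F 0. augmentation F x = 0} = differential F 0 ` free_mod F (Suc 0) \<and>
     (\<forall>i. {x \<in> free_mod F (Suc i). differential F i x = (\<lambda>_. 0)}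
            = differential F (Suc i) ` free_mod F (Suc (Suc i)))"

text \<open>The complex \<open>F \<otimes> K\<close>, where \<open>K = S / (variables)\<close>: its degree \<open>j\<close> part in position \<open>i\<close> is
  the vector space on the basis elements of \<open>F i\<close> of degree \<open>j\<close>, and its differentials are given by
  the constant terms of the matrix entries.\<close>

definition tensor_K :: "('v, 'k::field) free_complex \<Rightarrow> nat \<Rightarrow> int \<Rightarrow> (nat \<Rightarrow> 'k) set" where
  "tensor_K F i j = {x. \<forall>b. x b \<noteq> 0 \<longrightarrow> b < rk F i \<and> shift F i b = j}"

definition tensor_differential ::
    "('v, 'k::field) free_complex \<Rightarrow> nat \<Rightarrow> (nat \<Rightarrow> 'k) \<Rightarrow> nat \<Rightarrow> 'k" where
  "tensor_differential F i x =
     (\<lambda>c. if c < rk F i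
          then \<Sum>b<rk F (Suc i). x b * Poly_Mapping.lookup (dif F i b c) 0 else 0)"

definition tensor_cycles :: "('v, 'k::field) free_complex \<Rightarrow> nat \<Rightarrow> int \<Rightarrow> (nat \<Rightarrow> 'k) set" where
  "tensor_cycles F i j = (case i of
       0 \<Rightarrow> tensor_K F 0 j
     | Suc i' \<Rightarrow> {x \<in> tensor_K F i j. tensor_differential F i' x = (\<lambda>_. 0)})"

definition tensor_boundaries ::
    "('v, 'k::field) free_complex \<Rightarrow> nat \<Rightarrow> int \<Rightarrow> (nat \<Rightarrow> 'k) set" where
  "tensor_boundaries F i j = tensor_differential F i ` tensor_K F (Suc i) j"

text \<open>\<open>Tor\<^sub>i(M, K)\<^sub>j \<noteq> 0\<close>. The homology of \<open>F \<otimes> K\<close> does not depend on the resolution \<open>F\<close>, so it is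
  immaterial which one is used.\<close>

definition Tor_nonzero :: "('v, 'k::field) mpoly set \<Rightarrow> nat \<Rightarrow> int \<Rightarrow> bool" where
  "Tor_nonzero M i j \<longleftrightarrow>
     (\<exists>F. graded_free_resolution F M \<and> tensor_cycles F i j \<noteq> tensor_boundaries F i j)"

text \<open>For finitely many variables and a nonzero homogeneous ideal \<open>M\<close> the set below is finite (by
  Hilbert's syzygy theorem) and nonempty; \<open>Max\<close> is unspecified for the zero ideal.\<close>

definition regularity :: "('v::finite, 'k::field) mpoly set \<Rightarrow> int" where
  "regularity M = Max {j - int i | i j. Tor_nonzero M i j}"


section \<open>Graphs and their ideals\<close>

text \<open>A finite simple graph is given by its edge set on the finite vertex type \<open>'v\<close>.\<close>

definition simple_graph :: "'v::finite set set \<Rightarrow> bool" where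
  "simple_graph E \<longleftrightarrow> (\<forall>e\<in>E. card e = 2)"

definition gap_free :: "'v::finite set set \<Rightarrow> bool" where
  "gap_free E \<longleftrightarrow>
     \<not> (\<exists>u v x y. {u, v} \<in> E \<and> {x, y} \<in> E \<and> {u, v} \<inter> {x, y} = {} \<and>
          (\<forall>p\<in>{u, v}. \<forall>q\<in>{x, y}. {p, q} \<notin> E))"

definition edge_ideal :: "'v::finite set set \<Rightarrow> ('v, 'k::field) mpoly set" where
  "edge_ideal E = ideal_gen {Var x * Var y | x y. {x, y} \<in> E}"

definition path3_ideal :: "'v::finite set set \<Rightarrow> ('v, 'k::field) mpoly set" where
  "path3_ideal E = ideal_gen {Var a * Var b * Var c | a b c.
     a \<noteq> b \<and> b \<noteq> c \<and> a \<noteq> c \<and> {a, b} \<in> E \<and> {b, c} \<in> E}"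

end

theory Submission
  imports Defs "HOL-Library.Countable"
begin

text \<open>Koszul homology computes Tor. Since \<open>G\<close> is gap free, a monomial in \<open>I\<close> but not in
  \<open>I\<^sub>3\<close> is divisible by exactly one edge \<open>e\<close>, so \<open>I / I\<^sub>3\<close> is the direct sum over the edges \<open>e\<close> of
  copies of \<open>S / (N(e))\<close>, shifted by 2, where \<open>N(e)\<close> is the set of variables adjacent to \<open>e\<close>.
  Hence the \<open>i\<close>-th Koszul homology of \<open>I / I\<^sub>3\<close> lives in degree \<open>i + 2\<close>, and the long exact sequence
  of \<open>0 \<rightarrow> I\<^sub>3 \<rightarrow> I \<rightarrow> I / I\<^sub>3 \<rightarrow> 0\<close> shows that a class of \<open>I\<^sub>3\<close> in position \<open>i\<close> and degree
  \<open>j \<noteq> i + 3\<close> persists in \<open>I\<close>. That the homology of \<open>F \<otimes> K\<close> for an arbitrary resolution \<open>F\<close> of an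
  ideal agrees with Koszul homology follows by dimension shifting in the double complex of \<open>F\<close> and the
  Koszul complex; the Taylor resolution shows that resolutions exist and bounds the nonzero Tor.\<close>

subsection \<open>Monomials and polynomials\<close>

text \<open>The constant 3 and the excluded degree \<open>j = int i + 3\<close> have one origin: the
  kernel of H_i(I_3) -> H_i(I) is the image of H_{i+1}(I / I_3), which sits in degree (i+1) + 2. The
  obstacle is to compute with I / I_3 without building quotient modules or the direct sum.
  Everything stays inside S: ideals are recognised by supports of monomials, chains are functions
  from vertex sets to polynomials, and passing to a quotient means deleting monomials. Homology is
  computed one vertex at a time by homotopies that divide by a monomial; the Taylor, Koszul and
  quotient complexes all go through \<open>simplex_complex\<close>. In the quotient, division by one
  variable commutes with multiplication by another only under an exchange property of the two
  ideals, and this is what gap freeness provides. A second obstacle lies in the definitions.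
  \<open>Tor_nonzero\<close> asks for some resolution, so the comparison has to hold for every one,
  and \<open>Max\<close> is informative only once the set is known to be finite and
  nonempty.\<close>

abbreviation "lookup \<equiv> Poly_Mapping.lookup"
abbreviation "keys \<equiv> Poly_Mapping.keys"

definition indm :: "'v::finite set \<Rightarrow> 'v \<Rightarrow>\<^sub>0 nat" where
  "indm s = Abs_poly_mapping (\<lambda>v. if v \<in> s then 1 else 0)"

lemma lookup_indm: "lookup (indm s) v = (if v \<in> s then 1 else 0)"
  unfolding indm_def by (subst lookup_Abs_poly_mapping) auto

lemma keys_indm [simp]: "keys (indm s) = s"
  by (auto simp: in_keys_iff lookup_indm split: if_splits)

lemma keys_add_monom: "keys (a + b :: 'v \<Rightarrow>\<^sub>0 nat) = keys a \<union> keys b"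
  by (auto simp: in_keys_iff lookup_add)

lemma minus_add_indm: "s \<subseteq> keys m \<Longrightarrow> m - indm s + indm s = m"
  by (rule poly_mapping_eqI) (auto simp: lookup_add lookup_minus lookup_indm in_keys_iff)

lemma add_minus_indm: "(m :: 'v::finite \<Rightarrow>\<^sub>0 nat) + indm s - indm s = m"
  by (rule poly_mapping_eqI) (auto simp: lookup_add lookup_minus)

lemma total_deg_UNIV: "total_deg (m :: 'v::finite \<Rightarrow>\<^sub>0 nat) = (\<Sum>v\<in>UNIV. lookup m v)"
  unfolding total_deg_def by (rule sum.mono_neutral_left) (auto simp: in_keys_iff)

lemma total_deg_add: "total_deg ((a :: 'v::finite \<Rightarrow>\<^sub>0 nat) + b) = total_deg a + total_deg b"
  by (simp add: total_deg_UNIV lookup_add sum.distrib)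

lemma total_deg_indm [simp]: "total_deg (indm s) = card s"
  by (simp add: total_deg_UNIV lookup_indm sum.If_cases)

definition sqmono :: "'v::finite set \<Rightarrow> ('v, 'k::field) mpoly" where
  "sqmono s = Poly_Mapping.single (indm s) 1"

text \<open>Subtraction of exponents truncates at 0; the case split on
  \<open>s \<subseteq> keys m\<close> makes \<open>m - indm s\<close> an honest quotient. Later
  identities between multiplication and division are checked coefficientwise with this rule.\<close>

lemma lookup_sqmono_mult:
  "lookup (sqmono s * p) m = (if s \<subseteq> keys m then lookup p (m - indm s) else 0)"
proof -
  have "lookup (sqmono s * p) m = (\<Sum>l. (\<Sum>q. lookup p q when m = l + q) when l = indm s)"
    unfolding lookup_mult sqmono_def lookup_single by (rule Sum_any.cong) (auto simp: when_def)
  also have "\<dots> = (\<Sum>q. lookup p q when m = indm s + q)"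
    by simp
  also have "\<dots> = (if s \<subseteq> keys m then lookup p (m - indm s) else 0)"
  proof (cases "s \<subseteq> keys m")
    case True
    have "m = indm s + q \<longleftrightarrow> q = m - indm s" for q
      using minus_add_indm[OF True] by (metis add.commute add_minus_indm)
    then show ?thesis using True by simp
  next
    case False
    then have "m \<noteq> indm s + q" for q
      by (auto simp: keys_add_monom)
    then show ?thesis using False by simp
  qed
  finally show ?thesis .
qed

lemma Var_eq_sqmono: "Var v = (sqmono {v} :: ('v::finite, 'k::field) mpoly)"
proof -
  have "indm {v} = Poly_Mapping.single v 1"
    by (rule poly_mapping_eqI) (auto simp: lookup_indm lookup_single when_def)
  then show ?thesis by (simp add: Var_def sqmono_def)
qed

lemma sqmono_mult: "s \<inter> t = {} \<Longrightarrow> sqmono s * sqmono t = sqmono (s \<union> t)"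
proof -
  assume "s \<inter> t = {}"
  then have "indm s + indm t = indm (s \<union> t)"
    by (intro poly_mapping_eqI) (auto simp: lookup_add lookup_indm)
  then show ?thesis by (simp add: sqmono_def mult_single)
qed

lemma homogeneous_sqmono: "homogeneous (int (card s)) (sqmono s :: ('v::finite, 'k::field) mpoly)"
  by (simp add: homogeneous_def sqmono_def)

section \<open>Selecting monomials, dividing by monomials, homogeneous components\<close>

definition filt :: "('m \<Rightarrow> bool) \<Rightarrow> ('m \<Rightarrow>\<^sub>0 'k) \<Rightarrow> ('m \<Rightarrow>\<^sub>0 'k::ab_group_add)" where
  "filt P p = Poly_Mapping.mapp (\<lambda>m c. if P m then c else 0) p"

lemma lookup_filt: "lookup (filt P p) m = (if P m then lookup p m else 0)"
  by (auto simp: filt_def lookup_mapp when_def in_keys_iff)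

lemma keys_filt: "keys (filt P p) = {m \<in> keys p. P m}"
  by (auto simp: in_keys_iff lookup_filt split: if_splits)

lemma filt_zero [simp]: "filt P 0 = 0"
  by (rule poly_mapping_eqI) (simp add: lookup_filt)

lemma filt_add: "filt P (p + q) = filt P p + filt P q"
  by (rule poly_mapping_eqI) (simp add: lookup_filt lookup_add)

lemma filt_sum: "filt P (sum f A) = (\<Sum>x\<in>A. filt P (f x))"
  by (rule poly_mapping_eqI) (simp add: lookup_filt lookup_sum)

text \<open>Partial inverse of multiplication by \<open>sqmono s\<close>: monomials that it does not
  divide are dropped. The guard \<open>Q\<close> restricts the quotients, so that division can be
  kept inside a monomial ideal.\<close>

definition qdiv :: "(('v \<Rightarrow>\<^sub>0 nat) \<Rightarrow> bool) \<Rightarrow> 'v::finite set \<Rightarrow> ('v, 'k::field) mpoly \<Rightarrow> ('v, 'k) mpoly" where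
  "qdiv Q s p = Abs_poly_mapping (\<lambda>m. if Q m then lookup p (m + indm s) else 0)"

lemma lookup_qdiv: "lookup (qdiv Q s p) m = (if Q m then lookup p (m + indm s) else 0)"
proof -
  have "{m. (if Q m then lookup p (m + indm s) else 0) \<noteq> 0} \<subseteq> (\<lambda>k. k - indm s) ` keys p"
  proof
    fix m assume "m \<in> {m. (if Q m then lookup p (m + indm s) else 0) \<noteq> 0}"
    then have "m + indm s \<in> keys p" by (auto simp: in_keys_iff split: if_splits)
    then show "m \<in> (\<lambda>k. k - indm s) ` keys p"
      by (rule rev_image_eqI) (simp add: add_minus_indm)
  qed
  then have "finite {m. (if Q m then lookup p (m + indm s) else 0) \<noteq> 0}"
    by (rule finite_subset) simp
  then show ?thesis unfolding qdiv_def by (subst lookup_Abs_poly_mapping) auto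
qed

lemma qdiv_zero [simp]: "qdiv Q s 0 = 0"
  by (rule poly_mapping_eqI) (simp add: lookup_qdiv)

lemma qdiv_add: "qdiv Q s (p + q) = qdiv Q s p + qdiv Q s q"
  by (rule poly_mapping_eqI) (simp add: lookup_qdiv lookup_add)

definition hcomp :: "int \<Rightarrow> ('v, 'k::field) mpoly \<Rightarrow> ('v, 'k) mpoly" where
  "hcomp d = filt (\<lambda>m. int (total_deg m) = d)"

lemma homogeneous_iff_hcomp: "homogeneous d p \<longleftrightarrow> hcomp d p = p"
proof
  assume "homogeneous d p"
  then show "hcomp d p = p"
    by (intro poly_mapping_eqI) (auto simp: homogeneous_def hcomp_def lookup_filt in_keys_iff)
next
  assume "hcomp d p = p"
  then have "keys p = {m \<in> keys p. int (total_deg m) = d}"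
    by (metis hcomp_def keys_filt)
  then show "homogeneous d p" by (auto simp: homogeneous_def)
qed

lemma hcomp_sum: "hcomp d (sum f A) = (\<Sum>x\<in>A. hcomp d (f x))"
  by (simp add: hcomp_def filt_sum)

lemma hcomp_zero [simp]: "hcomp d 0 = 0"
  by (simp add: hcomp_def)

text \<open>Multiplication by a homogeneous \<open>q\<close> shifts all degrees by \<open>e\<close>,
  whatever \<open>p\<close> is. Hence differentials with homogeneous entries commute with projection
  to a degree.\<close>

lemma hcomp_mult:
  fixes p q :: "('v::finite, 'k::field) mpoly"
  assumes "homogeneous e q"
  shows "hcomp d (p * q) = hcomp (d - e) p * q"
proof (rule poly_mapping_eqI)
  fix m
  let ?S = "\<lambda>l. (\<Sum>b. lookup q b when m = l + b)"
  have S: "int (total_deg m) = int (total_deg l) + e" if "?S l \<noteq> 0" for l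
  proof -
    obtain b where "(lookup q b when m = l + b) \<noteq> 0"
      using \<open>?S l \<noteq> 0\<close> by (rule Sum_any.not_neutral_obtains_not_neutral)
    then have "m = l + b" "b \<in> keys q" by (auto simp: in_keys_iff)
    then show ?thesis using assms by (auto simp: homogeneous_def total_deg_add)
  qed
  show "lookup (hcomp d (p * q)) m = lookup (hcomp (d - e) p * q) m"
  proof (cases "int (total_deg m) = d")
    case True
    have "lookup p l * ?S l = lookup (hcomp (d - e) p) l * ?S l" for l
      using S[of l] True by (cases "?S l = 0") (auto simp: hcomp_def lookup_filt)
    then have "(\<Sum>l. lookup p l * ?S l) = (\<Sum>l. lookup (hcomp (d - e) p) l * ?S l)"
      by (simp only:)
    moreover have "lookup (hcomp d (p * q)) m = lookup (p * q) m"
      using True by (simp add: hcomp_def lookup_filt)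
    ultimately show ?thesis
      by (simp only: lookup_mult)
  next
    case False
    have "lookup (hcomp (d - e) p) l * ?S l = 0" for l
      using S[of l] False by (cases "?S l = 0") (auto simp: hcomp_def lookup_filt)
    then show ?thesis
      using False by (simp only: lookup_mult hcomp_def lookup_filt) simp
  qed
qed

text \<open>A sum of exponent vectors vanishes only if both do. So the constant term is the ring
  homomorphism from S to K, which is how \<open>tensor_differential\<close> arises from
  \<open>differential\<close>.\<close>

lemma lookup_mult_zero:
  fixes p q :: "('v::finite, 'k::field) mpoly"
  shows "lookup (p * q) 0 = lookup p 0 * lookup q 0"
proof -
  have z: "(0 :: 'v \<Rightarrow>\<^sub>0 nat) = l + b \<longleftrightarrow> l = 0 \<and> b = 0" for l b
    by (auto simp: poly_mapping_eq_iff fun_eq_iff lookup_add)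
  have "(\<Sum>b. lookup q b when 0 = l + b) = (lookup q 0 when l = 0)" for l
    unfolding z by (cases "l = 0") simp_all
  then have "lookup (p * q) 0 = (\<Sum>l. (lookup p l * lookup q 0 when l = 0))"
    unfolding lookup_mult by (simp add: mult_when)
  then show ?thesis by simp
qed

subsection \<open>Complexes with simplicial signs\<close>

text \<open>The usual simplicial sign. It needs some linear order on the vertices; a finite type is
  countable, so \<open>to_nat\<close> supplies one.\<close>

definition sg :: "'a::finite \<Rightarrow> 'a set \<Rightarrow> 'r::comm_ring_1" where
  "sg v t = (-1) ^ card {u \<in> t. to_nat u < to_nat v}"

lemma sg_square: "sg v t * sg v t = (1 :: 'r::comm_ring_1)"
  by (simp add: sg_def flip: power_mult_distrib)

lemma sg_square_left: "sg v t * (sg v t * x) = (x :: 'r::comm_ring_1)"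
  by (metis sg_square mult.assoc mult_1)

lemma sg_cases: "sg v t = (1 :: 'r::comm_ring_1) \<or> sg v t = (-1 :: 'r)"
  unfolding sg_def by (metis neg_one_even_power neg_one_odd_power)

text \<open>Exactly one of \<open>u\<close>, \<open>v\<close> precedes the other, so adding the
  other vertex changes just one of the two counts.\<close>

lemma sg_exchange:
  fixes u v :: "'a::finite"
  assumes "u \<noteq> v" "u \<notin> t" "v \<notin> t"
  shows "sg u (insert v t) * sg v t = - (sg v (insert u t) * sg u t :: 'r::comm_ring_1)"
proof -
  have ne: "to_nat u \<noteq> to_nat v" using assms by simp
  have c: "card {w \<in> insert b t. to_nat w < to_nat a} = card {w \<in> t. to_nat w < to_nat a} + (if to_nat b < to_nat a then 1 else 0)"
    if "b \<notin> t" for a b :: 'a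
  proof -
    have "{w \<in> insert b t. to_nat w < to_nat a} = (if to_nat b < to_nat a then insert b {w \<in> t. to_nat w < to_nat a} else {w \<in> t. to_nat w < to_nat a})"
      by auto
    then show ?thesis using that by simp
  qed
  show ?thesis
    unfolding sg_def c[OF assms(2)] c[OF assms(3)] using ne
    by (cases "to_nat u < to_nat v") (auto simp: power_add)
qed

text \<open>A chain lives on all vertex sets at once; homological positions are cut out afterwards
  by cardinality.\<close>

definition simplex_bd ::
    "('a::finite \<Rightarrow> 'a set \<Rightarrow> 'r \<Rightarrow> 'r) \<Rightarrow> ('a set \<Rightarrow> 'r) \<Rightarrow> 'a set \<Rightarrow> 'r::comm_ring_1" where
  "simplex_bd X f t = (\<Sum>v\<in>-t. sg v t * X v t (f (insert v t)))"

definition simplex_ht ::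
    "('a::finite \<Rightarrow> 'a set \<Rightarrow> 'r \<Rightarrow> 'r) \<Rightarrow> 'a \<Rightarrow> ('a set \<Rightarrow> 'r) \<Rightarrow> 'a set \<Rightarrow> 'r::comm_ring_1" where
  "simplex_ht D v f s = (if v \<in> s then sg v (s - {v}) * D v (s - {v}) (f (s - {v})) else 0)"

text \<open>\<open>X v t\<close> multiplies along the face \<open>t\<close> of \<open>insert v t\<close> and \<open>D v t\<close> is the partial inverse
  dividing by the same monomial. The commutator of the boundary with the homotopy \<open>D v\<close> is the
  projection to the terms satisfying \<open>R v\<close>.\<close>

locale simplex_complex =
  fixes X D :: "'a::finite \<Rightarrow> 'a set \<Rightarrow> ('v::finite, 'k::field) mpoly \<Rightarrow> ('v, 'k) mpoly"
    and C :: "'a set \<Rightarrow> ('v, 'k) mpoly set"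
    and V :: "'a set"
    and R :: "'a \<Rightarrow> 'a set \<Rightarrow> ('v \<Rightarrow>\<^sub>0 nat) \<Rightarrow> bool"
  assumes X_add: "X v t (p + q) = X v t p + X v t q"
    and D_add: "D v t (p + q) = D v t p + D v t q"
    and C_0: "0 \<in> C s"
    and C_add: "p \<in> C s \<Longrightarrow> q \<in> C s \<Longrightarrow> p + q \<in> C s"
    and C_uminus: "p \<in> C s \<Longrightarrow> - p \<in> C s"
    and C_filt: "p \<in> C s \<Longrightarrow> filt Q p \<in> C s"
    and C_D: "v \<in> V \<Longrightarrow> v \<notin> t \<Longrightarrow> p \<in> C t \<Longrightarrow> D v t p \<in> C (insert v t)"
    and X_X: "u \<noteq> v \<Longrightarrow> u \<notin> t \<Longrightarrow> v \<notin> t \<Longrightarrow> X u t (X v (insert u t) p) = X v t (X u (insert v t) p)"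
    and D_X: "v \<in> V \<Longrightarrow> u \<noteq> v \<Longrightarrow> u \<notin> t \<Longrightarrow> v \<notin> t \<Longrightarrow> p \<in> C (insert u t) \<Longrightarrow>
        D v t (X u t p) = X u (insert v t) (D v (insert u t) p)"
    and D_X_same: "v \<in> V \<Longrightarrow> v \<notin> t \<Longrightarrow> p \<in> C (insert v t) \<Longrightarrow> D v t (X v t p) = filt (R v (insert v t)) p"
    and X_D_same: "v \<in> V \<Longrightarrow> v \<notin> s \<Longrightarrow> p \<in> C s \<Longrightarrow> X v s (D v s p) = filt (R v s) p"
begin

lemma X_0 [simp]: "X v t 0 = 0"
  using X_add[of v t 0 0] by simp

lemma D_0 [simp]: "D v t 0 = 0"
  using D_add[of v t 0 0] by simp

lemma X_uminus: "X v t (- p) = - X v t p"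
  using X_add[of v t "- p" p] by (simp add: eq_neg_iff_add_eq_0)

lemma D_uminus: "D v t (- p) = - D v t p"
  using D_add[of v t "- p" p] by (simp add: eq_neg_iff_add_eq_0)

lemma X_sg: "X v t (sg u s * p) = sg u s * X v t p"
  using sg_cases[of u s, where 'r = "('v, 'k) mpoly"] by (auto simp: X_uminus)

lemma D_sg: "D v t (sg u s * p) = sg u s * D v t p"
  using sg_cases[of u s, where 'r = "('v, 'k) mpoly"] by (auto simp: D_uminus)

lemma C_sg: "p \<in> C s \<Longrightarrow> sg u t * p \<in> C s"
  using sg_cases[of u t, where 'r = "('v, 'k) mpoly"] by (auto simp: C_uminus)

lemma X_sum: "X v t (sum f A) = (\<Sum>x\<in>A. X v t (f x))"
  by (induction A rule: infinite_finite_induct) (auto simp: X_add)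

lemma D_sum: "D v t (sum f A) = (\<Sum>x\<in>A. D v t (f x))"
  by (induction A rule: infinite_finite_induct) (auto simp: D_add)

abbreviation "bd \<equiv> simplex_bd X"

abbreviation "ht \<equiv> simplex_ht D"

lemma bd_add: "bd (\<lambda>s. f s + g s) t = bd f t + bd g t"
  by (simp add: simplex_bd_def X_add algebra_simps sum.distrib)

lemma bd_uminus: "bd (\<lambda>s. - f s) t = - bd f t"
  by (simp add: simplex_bd_def X_uminus sum_negf)

lemma bd_diff: "bd (\<lambda>s. f s - g s) t = bd f t - bd g t"
  using bd_add[of f "\<lambda>s. - g s"] by (simp add: bd_uminus)

lemma bd_zero: "bd (\<lambda>_. 0) t = 0"
  by (simp add: simplex_bd_def)

lemma bd_bd: "bd (bd f) t = 0"
proof -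
  let ?T = "\<lambda>u v. sg u t * sg v (insert u t) * X u t (X v (insert u t) (f (insert v (insert u t))))"
  have swap: "?T v u = - ?T u v" if "u \<noteq> v" "u \<notin> t" "v \<notin> t" for u v
    using sg_exchange[OF that, where 'r = "('v, 'k) mpoly"] X_X[OF that]
    by (simp add: mult.commute insert_commute)
  let ?S = "{(u, v). u \<notin> t \<and> v \<notin> t \<and> to_nat u < to_nat v}"
  let ?S' = "{(u, v). u \<notin> t \<and> v \<notin> t \<and> to_nat v < to_nat u}"
  have "bd (bd f) t = (\<Sum>u\<in>-t. \<Sum>v\<in>-insert u t. ?T u v)"
    by (simp add: simplex_bd_def X_sum X_sg sum_distrib_left mult.assoc)
  also have "\<dots> = (\<Sum>(u, v)\<in>(SIGMA u:-t. -insert u t). ?T u v)"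
    by (rule sum.Sigma) auto
  \<comment> \<open>Cancelling each ordered pair against its swap also covers characteristic 2,
    where a sum equal to its own negative need not vanish.\<close>
  also have "(SIGMA u:-t. -insert u t) = ?S \<union> ?S'"
    by (auto, metis from_nat_to_nat linorder_neqE_nat)
  also have "(\<Sum>(u, v)\<in>?S \<union> ?S'. ?T u v) = (\<Sum>(u, v)\<in>?S. ?T u v) + (\<Sum>(u, v)\<in>?S'. ?T u v)"
    by (rule sum.union_disjoint) auto
  also have "(\<Sum>(u, v)\<in>?S'. ?T u v) = (\<Sum>(u, v)\<in>?S. ?T v u)"
    by (rule sum.reindex_bij_witness[of _ prod.swap prod.swap]) auto
  also have "\<dots> = (\<Sum>(u, v)\<in>?S. - ?T u v)"
  proof (rule sum.cong)
    fix p assume "p \<in> ?S"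
    then show "(case p of (u, v) \<Rightarrow> ?T v u) = (case p of (u, v) \<Rightarrow> - ?T u v)"
      using swap[of "fst p" "snd p"] by (cases p) auto
  qed simp
  finally show ?thesis by (simp only: sum_negf split_def) simp
qed

text \<open>Cone argument with apex \<open>v\<close>: \<open>ht v\<close> adds \<open>v\<close> to a
  cell and divides. The summand in direction \<open>v\<close> composes multiplication with division
  and leaves the filter; in all other directions \<open>D v\<close> commutes with \<open>X u\<close>
  and the signs cancel.\<close>

lemma homotopy:
  assumes v: "v \<in> V" and f: "\<And>s. f s \<in> C s"
  shows "bd (ht v f) s + ht v (bd f) s = filt (R v s) (f s)"
proof (cases "v \<in> s")
  case True
  define t where "t = s - {v}"
  have vt: "v \<notin> t" and s: "s = insert v t" using True by (auto simp: t_def)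
  have "ht v (bd f) s = (\<Sum>u\<in>-t. sg v t * (sg u t * D v t (X u t (f (insert u t)))))"
    using True by (simp add: simplex_ht_def simplex_bd_def D_sum D_sg sum_distrib_left flip: t_def)
  also have "-t = insert v (-s)" using vt s by auto
  also have "(\<Sum>u\<in>insert v (-s). sg v t * (sg u t * D v t (X u t (f (insert u t))))) =
     filt (R v s) (f s) + (\<Sum>u\<in>-s. sg v t * (sg u t * D v t (X u t (f (insert u t)))))"
    using True D_X_same[OF v vt, of "f s"] f[of s] by (simp add: s sg_square_left)
  finally have 1: "ht v (bd f) s = filt (R v s) (f s) + (\<Sum>u\<in>-s. sg v t * (sg u t * D v t (X u t (f (insert u t)))))" .
  have "bd (ht v f) s = (\<Sum>u\<in>-s. - (sg v t * (sg u t * D v t (X u t (f (insert u t))))))"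
    unfolding simplex_bd_def
  proof (rule sum.cong)
    fix u assume "u \<in> -s"
    then have u: "u \<noteq> v" "u \<notin> t" using s by auto
    have i: "insert u s - {v} = insert u t" using u s vt by auto
    have "sg u s * X u s (ht v f (insert u s)) = sg u s * sg v (insert u t) * X u s (D v (insert u t) (f (insert u t)))"
      using True by (simp add: simplex_ht_def i X_sg)
    also have "X u s (D v (insert u t) (f (insert u t))) = D v t (X u t (f (insert u t)))"
      using D_X[OF v u vt f] s by simp
    also have "sg u s * sg v (insert u t) = - (sg v t * sg u t :: ('v, 'k) mpoly)"
    proof -
      have "sg u s * sg v t = - (sg v (insert u t) * sg u t :: ('v, 'k) mpoly)"
        using sg_exchange[OF u vt] s by simp
      \<comment> \<open>Multiplying the exchange law by both signs of \<open>v\<close> moves them to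
        the other side, their squares being 1.\<close>
      then have "sg u s * sg v t * (sg v t * sg v (insert u t)) =
          - (sg v (insert u t) * sg u t) * (sg v t * sg v (insert u t) :: ('v, 'k) mpoly)" by simp
      then have "sg u s * (sg v t * (sg v t * sg v (insert u t))) =
          - (sg v (insert u t) * (sg v (insert u t) * (sg u t * sg v t)) :: ('v, 'k) mpoly)"
        by (simp only: mult_ac minus_mult_left)
      then have "sg u s * sg v (insert u t) = - (sg u t * sg v t :: ('v, 'k) mpoly)"
        by (simp only: sg_square_left)
      then show ?thesis by (simp only: mult.commute)
    qed
    finally show "sg u s * X u s (ht v f (insert u s)) = - (sg v t * (sg u t * D v t (X u t (f (insert u t)))))"
      by (simp add: mult_ac)
  qed simp
  with 1 show ?thesis by (simp add: sum_negf)
next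
  case False
  have "bd (ht v f) s = (\<Sum>u\<in>-s. if u = v then sg v s * X v s (sg v s * D v s (f s)) else 0)"
    unfolding simplex_bd_def
  proof (rule sum.cong)
    fix u assume "u \<in> -s"
    then show "sg u s * X u s (ht v f (insert u s)) = (if u = v then sg v s * X v s (sg v s * D v s (f s)) else 0)"
      using False by (auto simp: simplex_ht_def)
  qed simp
  also have "\<dots> = X v s (D v s (f s))"
    using False by (simp add: X_sg sg_square_left)
  also have "\<dots> = filt (R v s) (f s)"
    using X_D_same[OF v False f] .
  finally show ?thesis using False by (simp add: simplex_ht_def)
qed

text \<open>The homotopies for the different \<open>v\<close> replace a cycle by homologous ones with fewer and fewer
  terms; only those not met by any \<open>R v\<close> survive.\<close>

lemma cycle_reduce:
  assumes f: "\<And>s. f s \<in> C s" and cyc: "bd f = (\<lambda>_. 0)" and W: "W \<subseteq> V"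
  shows "\<exists>u. (\<forall>s. u s \<in> C s) \<and> (\<forall>s. f s = bd u s + filt (\<lambda>m. \<forall>v\<in>W. \<not> R v s m) (f s))"
proof -
  have "finite W" by simp
  then show ?thesis using W
  proof (induction W rule: finite_induct)
    case empty
    have "filt (\<lambda>m. \<forall>v\<in>{}. \<not> R v s m) (f s) = f s" for s
      by (rule poly_mapping_eqI) (simp add: lookup_filt)
    then show ?case
      by (intro exI[of _ "\<lambda>_. 0"]) (simp add: bd_zero C_0)
  next
    case (insert v W)
    then obtain u where u: "\<And>s. u s \<in> C s"
      and eq: "\<And>s. f s = bd u s + filt (\<lambda>m. \<forall>v\<in>W. \<not> R v s m) (f s)" by auto
    define w where "w s = filt (\<lambda>m. \<forall>v\<in>W. \<not> R v s m) (f s)" for s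
    have wC: "w s \<in> C s" for s using f by (simp add: w_def C_filt)
    have "w = (\<lambda>s. f s - bd u s)" using eq by (auto simp: w_def fun_eq_iff algebra_simps)
    then have "bd w t = 0" for t
      using bd_diff[of f "bd u" t] cyc by (simp add: bd_bd)
    then have "bd w = (\<lambda>_. 0)" by auto
    \<comment> \<open>The remainder \<open>w\<close> is still a cycle, so the homotopy identity
      loses its second term and exhibits the \<open>R v\<close> part of \<open>w\<close> as a
      boundary.\<close>
    then have "ht v (bd w) = (\<lambda>_. 0)" by (auto simp: simplex_ht_def)
    then have h: "bd (ht v w) s = filt (R v s) (w s)" for s
      using homotopy[of v w s] insert.prems wC by simp
    have hC: "ht v w s \<in> C s" for s
    proof (cases "v \<in> s")
      case True
      then show ?thesis using C_D[of v "s - {v}" "w (s - {v})"] insert.prems wC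
        by (auto simp: simplex_ht_def insert_absorb intro: C_sg)
    qed (simp add: simplex_ht_def C_0)
    have "f s = bd (\<lambda>s. u s + ht v w s) s + filt (\<lambda>m. \<forall>v\<in>insert v W. \<not> R v s m) (f s)" for s
    proof -
      have "w s = filt (R v s) (w s) + filt (\<lambda>m. \<forall>v\<in>insert v W. \<not> R v s m) (f s)"
        unfolding w_def by (rule poly_mapping_eqI) (auto simp: lookup_filt lookup_add)
      then show ?thesis using eq[of s] by (simp add: bd_add h add.assoc flip: w_def)
    qed
    then show ?case using u hC by (intro exI[of _ "\<lambda>s. u s + ht v w s"]) (auto intro: C_add)
  qed
qed

end

subsection \<open>Acyclicity of Taylor and Koszul complexes\<close>

text \<open>The factor is the lcm of the labels of \<open>insert v t\<close> divided by that of
  \<open>t\<close>, for squarefree monomials given by supports. Generators as labels give the Taylor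
  differential, singletons the Koszul differential.\<close>

definition lcm_mult ::
    "('a::finite \<Rightarrow> 'v::finite set) \<Rightarrow> 'a \<Rightarrow> 'a set \<Rightarrow> ('v, 'k::field) mpoly \<Rightarrow> ('v, 'k) mpoly" where
  "lcm_mult lab v t p = sqmono (lab v - \<Union>(lab ` t)) * p"

text \<open>A monomial on the cell \<open>s\<close> has as multidegree its product with the lcm of
  the labels. The last predicate says that the label of \<open>v\<close> divides this multidegree;
  exactly then \<open>v\<close> can serve as apex of a cone.\<close>

lemma simplex_complex_lcm:
  fixes lab :: "'a::finite \<Rightarrow> 'v::finite set"
  shows "simplex_complex (lcm_mult lab)
    (\<lambda>v t. qdiv (\<lambda>_. True) (lab v - \<Union>(lab ` t)))
    (\<lambda>s. if s \<subseteq> G then UNIV else {0 :: ('v, 'k::field) mpoly}) G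
    (\<lambda>v s m. v \<in> s \<or> lab v - \<Union>(lab ` s) \<subseteq> keys m)"
proof
  fix u v :: 'a and t and p :: "('v, 'k) mpoly"
  assume uv: "u \<noteq> v"
  let ?U = "\<Union>(lab ` t)"
  have lu: "lookup (m + indm a - indm b) x = lookup m x + (if x \<in> a then 1 else 0) - (if x \<in> b then 1 else 0)"
    for m :: "'v \<Rightarrow>\<^sub>0 nat" and a b x
    by (simp add: lookup_add lookup_minus lookup_indm)
  have lu': "lookup (m - indm b + indm a) x = lookup m x - (if x \<in> b then 1 else 0) + (if x \<in> a then 1 else 0)"
    for m :: "'v \<Rightarrow>\<^sub>0 nat" and a b x
    by (simp add: lookup_add lookup_minus lookup_indm)
  show "lcm_mult lab u t (lcm_mult lab v (insert u t) p) = lcm_mult lab v t (lcm_mult lab u (insert v t) p)"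
    unfolding lcm_mult_def mult.assoc[symmetric]
    by (subst (1 2) sqmono_mult) (auto intro!: arg_cong2[where f = "(*)"] arg_cong[where f = sqmono])
  show "qdiv (\<lambda>_. True) (lab v - ?U) (lcm_mult lab u t p) =
    lcm_mult lab u (insert v t) (qdiv (\<lambda>_. True) (lab v - \<Union>(lab ` insert u t)) p)"
  proof (rule poly_mapping_eqI)
    fix m :: "'v \<Rightarrow>\<^sub>0 nat"
    have c: "lab u - ?U \<subseteq> keys (m + indm (lab v - ?U)) \<longleftrightarrow> lab u - \<Union>(lab ` insert v t) \<subseteq> keys m"
      by (auto simp: keys_add_monom)
    have e: "m + indm (lab v - ?U) - indm (lab u - ?U) =
       m - indm (lab u - \<Union>(lab ` insert v t)) + indm (lab v - \<Union>(lab ` insert u t))"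
      if "lab u - \<Union>(lab ` insert v t) \<subseteq> keys m"
    proof (rule poly_mapping_eqI)
      fix x
      have "x \<in> lab u - \<Union>(lab ` insert v t) \<Longrightarrow> lookup m x > 0"
        using that by (auto simp: in_keys_iff)
      then show "lookup (m + indm (lab v - ?U) - indm (lab u - ?U)) x =
        lookup (m - indm (lab u - \<Union>(lab ` insert v t)) + indm (lab v - \<Union>(lab ` insert u t))) x"
        unfolding lu lu' by auto
    qed
    show "lookup (qdiv (\<lambda>_. True) (lab v - ?U) (lcm_mult lab u t p)) m =
      lookup (lcm_mult lab u (insert v t) (qdiv (\<lambda>_. True) (lab v - \<Union>(lab ` insert u t)) p)) m"
      unfolding lookup_qdiv lcm_mult_def lookup_sqmono_mult c using e by simp
  qed
next
  fix v :: 'a and t and p :: "('v, 'k) mpoly"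
  assume "v \<notin> t"
  show "qdiv (\<lambda>_. True) (lab v - \<Union>(lab ` t)) (lcm_mult lab v t p) =
     filt (\<lambda>m. v \<in> insert v t \<or> lab v - \<Union>(lab ` insert v t) \<subseteq> keys m) p"
    by (rule poly_mapping_eqI)
      (simp add: lookup_qdiv lcm_mult_def lookup_sqmono_mult lookup_filt keys_add_monom add_minus_indm)
  show "lcm_mult lab v t (qdiv (\<lambda>_. True) (lab v - \<Union>(lab ` t)) p) =
     filt (\<lambda>m. v \<in> t \<or> lab v - \<Union>(lab ` t) \<subseteq> keys m) p"
    using \<open>v \<notin> t\<close>
    by (intro poly_mapping_eqI)
      (simp add: lookup_qdiv lcm_mult_def lookup_sqmono_mult lookup_filt minus_add_indm)
qed (auto simp: lcm_mult_def distrib_left qdiv_add split: if_splits)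

text \<open>Nothing survives the reduction by all vertices of \<open>G\<close>: on a nonempty cell
  each of its own vertices is an apex, and on the empty cell \<open>f0\<close> supplies one, since
  there it says that \<open>f {}\<close> lies in the ideal generated by the labels.\<close>

lemma lcm_complex_acyclic:
  fixes lab :: "'a::finite \<Rightarrow> 'v::finite set" and f :: "'a set \<Rightarrow> ('v, 'k::field) mpoly"
  assumes supp: "\<And>s. \<not> s \<subseteq> G \<Longrightarrow> f s = 0"
    and cyc: "simplex_bd (lcm_mult lab) f = (\<lambda>_. 0)"
    and f0: "\<And>m. m \<in> keys (f {}) \<Longrightarrow> \<exists>v\<in>G. lab v \<subseteq> keys m"
  shows "\<exists>u. (\<forall>s. \<not> s \<subseteq> G \<longrightarrow> u s = 0) \<and> simplex_bd (lcm_mult lab) u = f"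
proof -
  interpret simplex_complex "lcm_mult lab" "\<lambda>v t. qdiv (\<lambda>_. True) (lab v - \<Union>(lab ` t))"
    "\<lambda>s. if s \<subseteq> G then UNIV else {0 :: ('v, 'k::field) mpoly}" G
    "\<lambda>v s m. v \<in> s \<or> lab v - \<Union>(lab ` s) \<subseteq> keys m"
    by (rule simplex_complex_lcm)
  let ?P = "\<lambda>s m. \<forall>v\<in>G. \<not> (v \<in> s \<or> lab v - \<Union>(lab ` s) \<subseteq> keys m)"
  obtain u where u: "\<And>s. u s \<in> (if s \<subseteq> G then UNIV else {0})"
    and eq: "\<And>s. f s = simplex_bd (lcm_mult lab) u s + filt (?P s) (f s)"
    using cycle_reduce[of f G] supp cyc by fastforce
  have "filt (?P s) (f s) = 0" for s
  proof (rule poly_mapping_eqI)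
    fix m
    show "lookup (filt (?P s) (f s)) m = lookup 0 m"
    proof (cases "s \<subseteq> G \<and> m \<in> keys (f s)")
      case True
      then have "\<not> ?P s m" using f0[of m] by (cases "s = {}") auto
      then show ?thesis unfolding lookup_filt by (simp only: if_False lookup_zero)
    next
      case False
      then have "lookup (f s) m = 0" using supp[of s] by (cases "s \<subseteq> G") (auto simp: in_keys_iff)
      then show ?thesis by (simp add: lookup_filt)
    qed
  qed
  moreover have "u s = 0" if "\<not> s \<subseteq> G" for s using u[of s] that by simp
  ultimately show ?thesis using eq
    by (intro exI[of _ u]) (auto simp: fun_eq_iff)
qed

section \<open>The Koszul complex on all variables\<close>

definition koszul :: "('v::finite set \<Rightarrow> ('v, 'k::field) mpoly) \<Rightarrow> 'v set \<Rightarrow> ('v, 'k) mpoly" where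
  "koszul = simplex_bd (\<lambda>v _ p. Var v * p)"

lemma koszul_eq: "koszul f t = (\<Sum>v\<in>-t. sg v t * (Var v * f (insert v t)))"
  by (simp add: koszul_def simplex_bd_def)

lemma koszul_eq_lcm: "koszul = simplex_bd (lcm_mult (\<lambda>v. {v}))"
  by (rule ext)+ (auto simp: koszul_eq simplex_bd_def lcm_mult_def Var_eq_sqmono insert_Diff_if
      intro!: sum.cong)

lemma koszul_koszul: "koszul (koszul f) = (\<lambda>_. 0)"
proof -
  interpret simplex_complex "lcm_mult (\<lambda>v :: 'a. {v})"
    "\<lambda>v t. qdiv (\<lambda>_. True) ({v} - \<Union>((\<lambda>v. {v}) ` t))"
    "\<lambda>s. if s \<subseteq> UNIV then UNIV else {0 :: ('a, 'b) mpoly}" UNIV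
    "\<lambda>v s m. v \<in> s \<or> {v} - \<Union>((\<lambda>v. {v}) ` s) \<subseteq> keys m"
    by (rule simplex_complex_lcm)
  show ?thesis by (simp add: koszul_eq_lcm fun_eq_iff bd_bd)
qed

text \<open>Every monomial except 1 is divisible by a variable, so the only homology over S is K in
  position 0, detected by the constant term of \<open>f {}\<close>.\<close>

lemma koszul_acyclic:
  assumes "koszul f = (\<lambda>_. 0)" and f0: "lookup (f {}) 0 = 0"
  shows "\<exists>u. koszul u = f"
proof -
  have "\<exists>v\<in>UNIV. {v} \<subseteq> keys m" if "m \<in> keys (f {})" for m
  proof -
    have "m \<noteq> 0" using that f0 by (auto simp: in_keys_iff)
    then show ?thesis by (auto simp: poly_mapping_eq_iff fun_eq_iff in_keys_iff)
  qed
  then show ?thesis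
    using lcm_complex_acyclic[of UNIV f "\<lambda>v. {v}"] assms by (auto simp: koszul_eq_lcm)
qed

lemma koszul_diff: "koszul (\<lambda>s. f s - g s) t = koszul f t - koszul g t"
  by (simp add: koszul_eq right_diff_distrib sum_subtractf)

lemma koszul_mult: "koszul (\<lambda>s. f s * p) t = koszul f t * p"
  by (simp add: koszul_eq sum_distrib_right mult.assoc)

lemma koszul_sum: "koszul (\<lambda>s. \<Sum>b\<in>A. f b s) t = (\<Sum>b\<in>A. koszul (f b) t)"
  by (simp add: koszul_eq sum_distrib_left) (rule sum.swap)

lemma koszul_lookup_zero: "lookup (koszul (f :: 'v::finite set \<Rightarrow> ('v, 'k::field) mpoly) t) 0 = 0"
proof -
  have "lookup (Var v * p) 0 = 0" for v :: 'v and p :: "('v, 'k) mpoly"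
    by (simp add: Var_eq_sqmono lookup_sqmono_mult)
  then show ?thesis
    by (simp add: koszul_eq lookup_sum lookup_mult_zero[of "sg _ _"])
qed

text \<open>The basis element of a cell \<open>s\<close> has degree \<open>card s\<close>. The
  differential drops one vertex and multiplies by its variable, so the total degree \<open>d\<close>
  is kept.\<close>

lemma koszul_hcomp:
  "koszul (\<lambda>s. if card s = Suc i then hcomp (d - int (Suc i)) (f s) else 0) t =
     (if card t = i then hcomp (d - int i) (koszul f t) else 0)"
proof -
  have H: "hcomp d (sg v t * (Var v * p)) = sg v t * (Var v * hcomp (d - 1) p)"
    for d v and p :: "('a, 'b) mpoly"
  proof -
    have v: "homogeneous 1 (Var v :: ('a, 'b) mpoly)"
      using homogeneous_sqmono[of "{v}"] by (simp add: Var_eq_sqmono)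
    have "hcomp d (Var v * p) = Var v * hcomp (d - 1) p" for d
      using hcomp_mult[OF v, of d p] by (simp add: mult.commute)
    moreover have "hcomp d (- p) = - hcomp d p" for d and p :: "('a, 'b) mpoly"
      by (rule poly_mapping_eqI) (simp add: hcomp_def lookup_filt)
    ultimately show ?thesis
      using sg_cases[of v t, where 'r = "('a, 'b) mpoly"] by auto
  qed
  have "koszul (\<lambda>s. if card s = Suc i then hcomp (d - int (Suc i)) (f s) else 0) t =
    (\<Sum>v\<in>-t. sg v t * (Var v * (if card t = i then hcomp (d - int i - 1) (f (insert v t)) else 0)))"
    unfolding koszul_eq by (rule sum.cong) (auto simp: algebra_simps)
  also have "\<dots> = (if card t = i then hcomp (d - int i) (koszul f t) else 0)"
    by (simp add: koszul_eq hcomp_sum H)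
  finally show ?thesis .
qed

text \<open>Koszul homology of the quotient of the monomial ideals given by the supports \<open>A\<close> and \<open>B\<close>:
  modulo \<open>B\<close> only terms remain in which every variable of the cell kills the monomial and no other
  variable can be divided out.\<close>

lemma koszul_quotient:
  fixes A B :: "'v::finite set \<Rightarrow> bool" and f :: "'v set \<Rightarrow> ('v, 'k::field) mpoly"
  assumes A: "\<And>S T. S \<subseteq> T \<Longrightarrow> A S \<Longrightarrow> A T" and B: "\<And>S T. S \<subseteq> T \<Longrightarrow> B S \<Longrightarrow> B T"
    and exch: "\<And>u v W. u \<noteq> v \<Longrightarrow> A (insert v W) \<Longrightarrow> \<not> B (insert v W) \<Longrightarrow>
       A (insert u W) \<and> \<not> B (insert u (insert v W)) \<longleftrightarrow> A W \<and> \<not> B (insert u W)"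
    and fA: "\<And>s m. m \<in> keys (f s) \<Longrightarrow> A (keys m)"
    and fB: "\<And>s m. m \<in> keys (koszul f s) \<Longrightarrow> B (keys m)"
  shows "\<exists>u. (\<forall>s. \<forall>m\<in>keys (u s). A (keys m)) \<and>
     (\<forall>s. \<forall>m\<in>keys (f s - koszul u s). B (keys m) \<or>
        A (keys m) \<and> \<not> B (keys m) \<and> (\<forall>v\<in>s. B (insert v (keys m))) \<and>
        (\<forall>v\<in>keys m - s. \<not> A (keys (m - indm {v}))))"
proof -
  let ?nB = "\<lambda>m. \<not> B (keys m)"
  \<comment> \<open>The quotient is modelled on the monomials in \<open>A\<close> outside
    \<open>B\<close>: products that fall into \<open>B\<close> are deleted, and a division counts
    only if its result is still in \<open>A\<close>.\<close>
  let ?X = "\<lambda>v t p. filt ?nB (Var v * p) :: ('v, 'k) mpoly"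
  let ?D = "\<lambda>v t p. qdiv (\<lambda>m. A (keys m) \<and> \<not> B (insert v (keys m))) {v} p"
  let ?C = "\<lambda>s. {p. \<forall>m\<in>keys p. A (keys m) \<and> \<not> B (keys m)}"
  let ?R = "\<lambda>v s m. if v \<in> s then \<not> B (insert v (keys m)) else v \<in> keys m \<and> A (keys (m - indm {v}))"
  have km: "insert v (keys (m - indm {v})) = keys m" if "v \<in> keys m" for v m
    using that by (auto simp: in_keys_iff lookup_minus lookup_indm split: if_splits)
  have C_iff: "p \<in> ?C s \<longleftrightarrow> (\<forall>m. lookup p m \<noteq> 0 \<longrightarrow> A (keys m) \<and> \<not> B (keys m))" for p :: "('v, 'k) mpoly" and s
    by (auto simp: in_keys_iff)
  interpret simplex_complex ?X ?D ?C UNIV ?R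
  proof
    fix u v :: 'v and t :: "'v set" and p :: "('v, 'k) mpoly"
    assume uv: "u \<noteq> v"
    \<comment> \<open>Deleting after each factor or only at the end agrees because \<open>B\<close>
      passes to multiples; the resulting formula is symmetric in \<open>u\<close> and
      \<open>v\<close>.\<close>
    have X: "lookup (?X u t (?X v (insert u t) p)) m =
      (if \<not> B (keys m) \<and> u \<in> keys m \<and> v \<in> keys m then lookup p (m - indm {u} - indm {v}) else 0)"
      if "u \<noteq> v" for u v t p m
    proof -
      have "v \<in> keys (m - indm {u}) \<longleftrightarrow> v \<in> keys m"
        using that by (simp add: in_keys_iff lookup_minus lookup_indm)
      moreover have "keys (m - indm {u}) \<subseteq> keys m"
        by (auto simp: in_keys_iff lookup_minus)
      ultimately show ?thesis
        using B by (auto simp: lookup_filt Var_eq_sqmono lookup_sqmono_mult)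
    qed
    show "?X u t (?X v (insert u t) p) = ?X v t (?X u (insert v t) p)"
      by (rule poly_mapping_eqI)
        (unfold X[OF uv] X[OF uv[symmetric]], auto simp: diff_diff_add add.commute)
    assume p: "p \<in> ?C (insert u t)"
    show "?D v t (?X u t p) = ?X u (insert v t) (?D v (insert u t) p)"
    proof (rule poly_mapping_eqI)
      fix m :: "'v \<Rightarrow>\<^sub>0 nat"
      show "lookup (?D v t (?X u t p)) m = lookup (?X u (insert v t) (?D v (insert u t) p)) m"
      proof (cases "u \<in> keys m")
        case True
        \<comment> \<open>With the factor \<open>u\<close> split off, both sides read the same
          coefficient of \<open>p\<close>, guarded by the two sides of \<open>exch\<close>. If that
          coefficient is nonzero, \<open>p\<close> being in \<open>?C\<close> supplies the premises
          of \<open>exch\<close>.\<close>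
        define w where "w = m - indm {u}"
        have m: "m = w + indm {u}" using True by (simp add: w_def minus_add_indm)
        have e: "w + indm {u} + indm {v} - indm {u} = w + indm {v}" "w + indm {u} - indm {u} = w"
          by (metis add.assoc add.commute add_minus_indm)+
        have k: "keys (w + indm {u}) = insert u (keys w)" "keys (w + indm {u} + indm {v}) = insert u (insert v (keys w))"
          "keys (w + indm {v}) = insert v (keys w)"
          by (auto simp: keys_add_monom)
        have L: "lookup (?D v t (?X u t p)) m = (if A (insert u (keys w)) \<and> \<not> B (insert u (insert v (keys w))) then lookup p (w + indm {v}) else 0)"
          by (simp add: m lookup_qdiv lookup_filt Var_eq_sqmono lookup_sqmono_mult k e insert_commute)
        have R: "lookup (?X u (insert v t) (?D v (insert u t) p)) m = (if A (keys w) \<and> \<not> B (insert v (keys w)) \<and> \<not> B (insert u (keys w)) then lookup p (w + indm {v}) else 0)"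
          by (simp add: m lookup_qdiv lookup_filt Var_eq_sqmono lookup_sqmono_mult k e)
        show ?thesis
        proof (cases "lookup p (w + indm {v}) = 0")
          case False
          then have "A (insert v (keys w))" "\<not> B (insert v (keys w))"
            using p unfolding C_iff by (auto simp: k)
          then show ?thesis unfolding L R using exch[OF uv, of "keys w"] by auto
        qed (simp add: L R)
      next
        case False
        then have "u \<notin> keys (m + indm {v})" using uv by (simp add: keys_add_monom)
        then show ?thesis using False
          by (simp add: lookup_qdiv lookup_filt Var_eq_sqmono lookup_sqmono_mult)
      qed
    qed
  next
    fix v :: 'v and t and p :: "('v, 'k) mpoly"
    assume "v \<notin> t" and p: "p \<in> ?C (insert v t)"
    show "?D v t (?X v t p) = filt (?R v (insert v t)) p"
    proof (rule poly_mapping_eqI)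
      fix m :: "'v \<Rightarrow>\<^sub>0 nat"
      show "lookup (?D v t (?X v t p)) m = lookup (filt (?R v (insert v t)) p) m"
        using p unfolding C_iff
        by (cases "lookup p m = 0") (auto simp: lookup_qdiv lookup_filt Var_eq_sqmono lookup_sqmono_mult keys_add_monom add_minus_indm)
    qed
  next
    fix v :: 'v and t and p :: "('v, 'k) mpoly"
    assume vt: "v \<notin> t" and p: "p \<in> ?C t"
    show "?X v t (?D v t p) = filt (?R v t) p"
    proof (rule poly_mapping_eqI)
      fix m :: "'v \<Rightarrow>\<^sub>0 nat"
      show "lookup (?X v t (?D v t p)) m = lookup (filt (?R v t) p) m"
        using p vt unfolding C_iff
        by (cases "lookup p m = 0"; cases "v \<in> keys m") (auto simp: lookup_qdiv lookup_filt Var_eq_sqmono lookup_sqmono_mult km minus_add_indm)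
    qed
  next
    fix p q :: "('v, 'k) mpoly" and s :: "'v set"
    assume "p \<in> ?C s" "q \<in> ?C s"
    then show "p + q \<in> ?C s" using keys_add[of p q] by auto
  next
    fix v :: 'v and t and p :: "('v, 'k) mpoly"
    show "p \<in> ?C t \<Longrightarrow> ?D v t p \<in> ?C (insert v t)"
      unfolding C_iff using B[OF subset_insertI, of _ v] by (auto simp: lookup_qdiv)
  qed (auto simp: filt_add distrib_left qdiv_add keys_filt in_keys_iff)
  define g where "g s = filt ?nB (f s)" for s
  have gC: "g s \<in> ?C s" for s using fA by (auto simp: g_def keys_filt)
  \<comment> \<open>Multiples of deleted monomials get deleted anyway, so filtering a chain is a
    chain map to the quotient complex.\<close>
  have fV: "filt ?nB (Var v * filt ?nB p) = filt ?nB (Var v * p)" for v and p :: "('v, 'k) mpoly"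
  proof (rule poly_mapping_eqI)
    fix m
    have "keys (m - indm {v}) \<subseteq> keys m"
      by (auto simp: in_keys_iff lookup_minus)
    then show "lookup (filt ?nB (Var v * filt ?nB p)) m = lookup (filt ?nB (Var v * p)) m"
      using B by (auto simp: lookup_filt Var_eq_sqmono lookup_sqmono_mult)
  qed
  have fsg: "filt ?nB (sg v t * p) = sg v t * filt ?nB p" for v :: 'v and t and p :: "('v, 'k) mpoly"
    using sg_cases[of v t, where 'r = "('v, 'k) mpoly"]
    by (elim disjE) (auto intro!: poly_mapping_eqI simp: lookup_filt)
  have bdX: "simplex_bd ?X (\<lambda>s. filt ?nB (h s)) t = filt ?nB (koszul h t)" "simplex_bd ?X h t = filt ?nB (koszul h t)" for h t
    by (simp_all add: simplex_bd_def koszul_eq filt_sum fsg fV)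
  have "filt ?nB (koszul f t) = 0" for t
    using fB by (intro poly_mapping_eqI) (auto simp: lookup_filt in_keys_iff)
  then have "simplex_bd ?X g = (\<lambda>_. 0)"
    unfolding g_def by (intro ext) (simp add: bdX)
  then obtain u where u: "\<And>s. u s \<in> ?C s"
    and eq: "\<And>s. g s = simplex_bd ?X u s + filt (\<lambda>m. \<forall>v\<in>UNIV. \<not> ?R v s m) (g s)"
    using cycle_reduce[where f = g and W = UNIV, OF gC] by auto
  have "B (keys m) \<or> A (keys m) \<and> \<not> B (keys m) \<and> (\<forall>v\<in>s. B (insert v (keys m))) \<and>
        (\<forall>v\<in>keys m - s. \<not> A (keys (m - indm {v})))" if m: "m \<in> keys (f s - koszul u s)" for s m
  proof (cases "B (keys m)")
    case False
    have "lookup (f s - koszul u s) m = lookup (g s) m - lookup (simplex_bd ?X u s) m"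
      using False by (simp add: g_def bdX lookup_filt lookup_minus)
    also have "\<dots> = lookup (filt (\<lambda>m. \<forall>v\<in>UNIV. \<not> ?R v s m) (g s)) m"
      by (subst (1) eq) (simp add: lookup_add)
    finally have *: "m \<in> keys (filt (\<lambda>m. \<forall>v\<in>UNIV. \<not> ?R v s m) (g s))"
      using m by (simp add: in_keys_iff)
    then have "\<forall>v. \<not> ?R v s m" "m \<in> keys (g s)" by (simp_all add: keys_filt)
    then show ?thesis using gC[of s] False by (auto split: if_splits)
  qed simp
  moreover have "\<forall>s. \<forall>m\<in>keys (u s). A (keys m)" using u by simp
  ultimately show ?thesis by (intro exI[of _ u] conjI allI ballI) simp_all
qed

subsection \<open>Tor as Koszul homology\<close>

text \<open>The kernel of \<open>H\<^sub>i(M) \<rightarrow> H\<^sub>i(S)\<close> on Koszul homology in degree \<open>j\<close>, with a class represented by a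
  chain \<open>g\<close> over \<open>S\<close> that it bounds. For \<open>M\<close> inside the maximal ideal this kernel is all of \<open>H\<^sub>i(M)\<close>.\<close>

definition koszul_Tor :: "('v::finite, 'k::field) mpoly set \<Rightarrow> nat \<Rightarrow> int \<Rightarrow> bool" where
  "koszul_Tor M i j \<longleftrightarrow>
     (\<exists>g. (\<forall>s. card s \<noteq> Suc i \<longrightarrow> g s = 0) \<and> (\<forall>s. homogeneous (j - int (Suc i)) (g s)) \<and>
        (\<forall>s. koszul g s \<in> M) \<and> \<not> (\<exists>h. (\<forall>s. h s \<in> M) \<and> koszul h = koszul g))"

text \<open>\<open>M_const\<close> puts \<open>M\<close> inside the maximal ideal; this provides the
  vanishing constant terms that Koszul exactness demands at the augmentation.\<close>

locale resolved_ideal =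
  fixes F :: "('v::finite, 'k::field) free_complex" and M :: "('v, 'k) mpoly set"
  assumes res: "graded_free_resolution F M"
    and M_const: "p \<in> M \<Longrightarrow> lookup p 0 = 0"
begin

text \<open>The resolution with the augmentation added as differential 0, so that position 0 is the ring
  \<open>S\<close> itself and position \<open>k + 1\<close> is \<open>F k\<close>.\<close>

definition Rk :: "nat \<Rightarrow> nat" where
  "Rk k = (case k of 0 \<Rightarrow> 1 | Suc l \<Rightarrow> rk F l)"

definition Sh :: "nat \<Rightarrow> nat \<Rightarrow> int" where
  "Sh k c = (case k of 0 \<Rightarrow> 0 | Suc l \<Rightarrow> shift F l c)"

definition Dm :: "nat \<Rightarrow> nat \<Rightarrow> nat \<Rightarrow> ('v, 'k) mpoly" where
  "Dm k b c = (case k of 0 \<Rightarrow> aug F b | Suc l \<Rightarrow> dif F l b c)"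

lemma Rk_simps [simp]: "Rk 0 = 1" "Rk (Suc l) = rk F l"
  and Sh_simps [simp]: "Sh 0 c = 0" "Sh (Suc l) c = shift F l c"
  and Dm_simps [simp]: "Dm 0 b c = aug F b" "Dm (Suc l) b c = dif F l b c"
  by (simp_all add: Rk_def Sh_def Dm_def)

lemma Dm_homogeneous:
  assumes "b < Rk (Suc k)" "c < Rk k"
  shows "homogeneous (Sh (Suc k) b - Sh k c) (Dm k b c)"
  using res assms unfolding graded_free_resolution_def by (cases k) auto

definition chains :: "nat \<Rightarrow> (nat \<Rightarrow> 'v set \<Rightarrow> ('v, 'k) mpoly) set" where
  "chains k = {x. \<forall>b\<ge>Rk k. x b = (\<lambda>_. 0)}"

definition rdif :: "nat \<Rightarrow> (nat \<Rightarrow> 'v set \<Rightarrow> ('v, 'k) mpoly) \<Rightarrow> nat \<Rightarrow> 'v set \<Rightarrow> ('v, 'k) mpoly" where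
  "rdif k x = (\<lambda>c s. if c < Rk k then \<Sum>b<Rk (Suc k). x b s * Dm k b c else 0)"

definition kz :: "(nat \<Rightarrow> 'v set \<Rightarrow> ('v, 'k) mpoly) \<Rightarrow> nat \<Rightarrow> 'v set \<Rightarrow> ('v, 'k) mpoly" where
  "kz x = (\<lambda>c. koszul (x c))"

text \<open>In position \<open>k\<close> the basis element for \<open>c\<close> and a cell
  \<open>s\<close> has degree \<open>Sh k c + card s\<close>, which leaves coefficient degree
  \<open>j - int i - Sh k c\<close> for total degree \<open>j\<close>.\<close>

definition pr :: "nat \<Rightarrow> nat \<Rightarrow> int \<Rightarrow> (nat \<Rightarrow> 'v set \<Rightarrow> ('v, 'k) mpoly) \<Rightarrow> nat \<Rightarrow> 'v set \<Rightarrow> ('v, 'k) mpoly" where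
  "pr k i j x = (\<lambda>c s. if card s = i then hcomp (j - int i - Sh k c) (x c s) else 0)"

definition dif2 :: "(nat \<Rightarrow> 'v set \<Rightarrow> ('v, 'k) mpoly) \<Rightarrow> (nat \<Rightarrow> 'v set \<Rightarrow> ('v, 'k) mpoly) \<Rightarrow> nat \<Rightarrow> 'v set \<Rightarrow> ('v, 'k) mpoly" where
  "dif2 x y = (\<lambda>c s. x c s - y c s)"

abbreviation zc :: "nat \<Rightarrow> 'v set \<Rightarrow> ('v, 'k) mpoly" where
  "zc \<equiv> (\<lambda>_ _. 0)"

lemma koszul_0 [simp]: "koszul (\<lambda>_. 0) = (\<lambda>_. 0)"
  by (auto simp: koszul_eq)

lemma kz_rdif: "kz (rdif k x) = rdif k (kz x)"
proof (intro ext)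
  fix c s
  show "kz (rdif k x) c s = rdif k (kz x) c s"
    by (cases "c < Rk k") (simp_all add: kz_def rdif_def koszul_sum koszul_mult)
qed

lemma kz_kz: "kz (kz x) = zc"
  by (simp add: kz_def koszul_koszul)

lemma kz_dif2: "kz (dif2 x y) = dif2 (kz x) (kz y)"
  by (intro ext) (simp add: kz_def dif2_def koszul_diff)

lemma rdif_dif2: "rdif k (dif2 x y) = dif2 (rdif k x) (rdif k y)"
  by (intro ext) (simp add: rdif_def dif2_def left_diff_distrib sum_subtractf)

lemma dif2_zc [simp]: "dif2 x zc = x"
  by (simp add: dif2_def)

lemma dif2_eq_zc: "dif2 x y = zc \<longleftrightarrow> x = y"
  by (auto simp: dif2_def fun_eq_iff)

lemma kz_pr: "kz (pr k (Suc i) j x) = pr k i j (kz x)"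
proof (intro ext)
  fix c s
  show "kz (pr k (Suc i) j x) c s = pr k i j (kz x) c s"
    unfolding kz_def pr_def diff_right_commute[of j _ "Sh k c"] by (rule koszul_hcomp)
qed

lemma rdif_pr: "rdif k (pr (Suc k) i j x) = pr k i j (rdif k x)"
proof (intro ext)
  fix c s
  show "rdif k (pr (Suc k) i j x) c s = pr k i j (rdif k x) c s"
  proof (cases "c < Rk k \<and> card s = i")
    case True
    have "hcomp (j - int i - Sh k c) (x b s * Dm k b c) = hcomp (j - int i - Sh (Suc k) b) (x b s) * Dm k b c"
      if "b < Rk (Suc k)" for b
      using hcomp_mult[OF Dm_homogeneous[OF that], of c "j - int i - Sh k c" "x b s"] True
      by (simp add: algebra_simps del: Rk_simps Sh_simps)
    then show ?thesis using True by (simp add: rdif_def pr_def hcomp_sum del: Rk_simps Sh_simps)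
  qed (auto simp: rdif_def pr_def)
qed

lemma pr_pr [simp]: "pr k i j (pr k i j x) = pr k i j x"
  by (intro ext) (auto simp: pr_def hcomp_def intro!: poly_mapping_eqI simp: lookup_filt)

lemma chains_rdif [simp]: "rdif k x \<in> chains k"
  by (simp add: chains_def rdif_def)

lemma chains_kz: "x \<in> chains k \<Longrightarrow> kz x \<in> chains k"
  by (simp add: chains_def kz_def)

lemma chains_dif2: "x \<in> chains k \<Longrightarrow> y \<in> chains k \<Longrightarrow> dif2 x y \<in> chains k"
  by (simp add: chains_def dif2_def)

lemma chains_pr: "x \<in> chains k \<Longrightarrow> pr k i j x \<in> chains k"
  by (auto simp: chains_def pr_def)

lemma free_mod_chains: "x \<in> chains (Suc k) \<Longrightarrow> (\<lambda>b. x b s) \<in> free_mod F k"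
  by (auto simp: chains_def free_mod_def)

lemma differential_rdif: "differential F k (\<lambda>b. x b s) = (\<lambda>c. rdif (Suc k) x c s)"
  by (auto simp: differential_def rdif_def)

lemma augmentation_rdif: "augmentation F (\<lambda>b. x b s) = rdif 0 x 0 s"
  by (auto simp: augmentation_def rdif_def)

lemma rdif_0_chains: "rdif 0 x c s = (if c = 0 then augmentation F (\<lambda>b. x b s) else 0)"
  by (auto simp: augmentation_def rdif_def)

text \<open>For \<open>rdif\<close> the cell \<open>s\<close> is a mere parameter, so exactness of
  \<open>F\<close> applies for each \<open>s\<close> separately and the preimages are chosen
  cellwise.\<close>

lemma rdif_exact:
  assumes x: "x \<in> chains (Suc k)" and "rdif k x = zc"
  shows "\<exists>y\<in>chains (Suc (Suc k)). rdif (Suc k) y = x"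
proof -
  have "\<exists>z. z \<in> free_mod F (Suc k) \<and> differential F k z = (\<lambda>b. x b s)" for s
  proof (cases k)
    case 0
    have "(\<lambda>b. x b s) \<in> {x \<in> free_mod F 0. augmentation F x = 0}"
      using assms 0 free_mod_chains[of x 0 s] by (simp add: augmentation_rdif)
    then have "(\<lambda>b. x b s) \<in> differential F 0 ` free_mod F (Suc 0)"
      using res unfolding graded_free_resolution_def by blast
    then show ?thesis using 0 by auto
  next
    case (Suc l)
    have "(\<lambda>b. x b s) \<in> {x \<in> free_mod F (Suc l). differential F l x = (\<lambda>_. 0)}"
      using assms Suc free_mod_chains[of x k s] by (simp add: differential_rdif)
    then have "(\<lambda>b. x b s) \<in> differential F (Suc l) ` free_mod F (Suc (Suc l))"
      using res unfolding graded_free_resolution_def by blast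
    then show ?thesis using Suc by auto
  qed
  then obtain z where z: "\<And>s. z s \<in> free_mod F (Suc k)" "\<And>s. differential F k (z s) = (\<lambda>b. x b s)"
    by metis
  define y where "y b s = z s b" for b s
  have "y \<in> chains (Suc (Suc k))"
    using z(1) by (auto simp: chains_def free_mod_def y_def)
  moreover have "rdif (Suc k) y = x"
  proof (intro ext)
    fix c s
    have "rdif (Suc k) y c s = differential F k (z s) c"
      using differential_rdif[of k y s] by (simp add: y_def fun_eq_iff)
    then show "rdif (Suc k) y c s = x c s" by (simp add: z)
  qed
  ultimately show ?thesis by blast
qed

lemma rdif_rdif:
  assumes x: "x \<in> chains (Suc (Suc k))"
  shows "rdif k (rdif (Suc k) x) = zc"
proof (intro ext)
  fix c s
  have D: "differential F k (\<lambda>b. x b s) \<in> differential F k ` free_mod F (Suc k)"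
    using free_mod_chains[OF x] by blast
  show "rdif k (rdif (Suc k) x) c s = 0"
  proof (cases k)
    case 0
    have "augmentation F (differential F 0 (\<lambda>b. x b s)) = 0"
      using D res 0 unfolding graded_free_resolution_def by blast
    then show ?thesis using 0 by (simp add: rdif_0_chains differential_rdif)
  next
    case (Suc l)
    have "differential F l (differential F k (\<lambda>b. x b s)) = (\<lambda>_. 0)"
      using D res Suc unfolding graded_free_resolution_def by blast
    then show ?thesis using Suc by (simp add: differential_rdif fun_eq_iff)
  qed
qed

lemma kz_exact:
  assumes x: "x \<in> chains k" and "kz x = zc" and x0: "\<And>c. lookup (x c {}) 0 = 0"
  shows "\<exists>y\<in>chains k. kz y = x"
proof -
  \<comment> \<open>Zero components are lifted to zero, so that the chosen preimage stays in
    \<open>chains k\<close>.\<close>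
  have "\<exists>u. koszul u = x c \<and> (x c = (\<lambda>_. 0) \<longrightarrow> u = (\<lambda>_. 0))" for c
  proof (cases "x c = (\<lambda>_. 0)")
    case False
    have "koszul (x c) = (\<lambda>_. 0)" using assms(2) by (simp add: kz_def fun_eq_iff)
    then show ?thesis using koszul_acyclic[of "x c"] x0 False by blast
  qed auto
  then obtain y where "\<And>c. koszul (y c) = x c" "\<And>c. x c = (\<lambda>_. 0) \<longrightarrow> y c = (\<lambda>_. 0)"
    by metis
  then show ?thesis using x by (intro bexI[of _ y]) (auto simp: kz_def chains_def)
qed

text \<open>Let Z_k be the image of \<open>rdif k\<close> in position \<open>k\<close>: the ideal
  \<open>M\<close> for k = 0 and a syzygy module of it afterwards. The condition says that the
  kernel of H_i(Z_k) -> H_i(position k) on Koszul homology is nonzero in degree \<open>j\<close>; it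
  is \<open>koszul_Tor\<close> with Z_k in place of \<open>M\<close>.\<close>

definition rel_class :: "nat \<Rightarrow> nat \<Rightarrow> int \<Rightarrow> bool" where
  "rel_class k i j \<longleftrightarrow> (\<exists>g\<in>chains k. pr k (Suc i) j g = g \<and> (\<exists>w\<in>chains (Suc k). kz g = rdif k w) \<and>
     \<not> (\<exists>w\<in>chains (Suc k). kz g = kz (rdif k w)))"

text \<open>A homogeneous lift \<open>w\<close> suffices: projections commute with both
  differentials, so replacing \<open>g\<close> by its part of the right degree leaves
  \<open>kz g\<close> unchanged.\<close>

lemma rel_classI:
  assumes "g \<in> chains k" "w \<in> chains (Suc k)" "kz g = rdif k w" "pr (Suc k) i j w = w"
    "\<And>u. u \<in> chains (Suc k) \<Longrightarrow> rdif k w = kz (rdif k u) \<Longrightarrow> False"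
  shows "rel_class k i j"
proof -
  have e: "kz (pr k (Suc i) j g) = rdif k w"
    using assms(3,4) by (metis kz_pr rdif_pr)
  show ?thesis unfolding rel_class_def
    using assms e by (intro bexI[of _ "pr k (Suc i) j g"]) (auto simp: chains_pr)
qed

lemma rel_classE:
  assumes "rel_class k i j"
  obtains g w where "g \<in> chains k" "w \<in> chains (Suc k)" "kz g = rdif k w" "pr (Suc k) i j w = w"
    "\<forall>u\<in>chains (Suc k). rdif k w \<noteq> kz (rdif k u)"
proof -
  obtain g w where g: "g \<in> chains k" "pr k (Suc i) j g = g" "w \<in> chains (Suc k)" "kz g = rdif k w"
    and n: "\<not> (\<exists>w\<in>chains (Suc k). kz g = kz (rdif k w))"
    using assms unfolding rel_class_def by auto
  have e: "kz g = rdif k (pr (Suc k) i j w)"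
    using g(2,4) by (metis kz_pr rdif_pr)
  show ?thesis
    using n g e by (intro that[of g "pr (Suc k) i j w"]) (auto simp: chains_pr)
qed

text \<open>Connecting map of 0 -> Z_{k+1} -> (position k+1) -> Z_k -> 0: the lift \<open>w\<close>
  of \<open>kz g\<close> along the row takes over the role of \<open>g\<close>, and conversely a
  Koszul preimage of \<open>rdif k g\<close> leads back.\<close>

lemma rel_class_shift: "rel_class k (Suc i) j \<longleftrightarrow> rel_class (Suc k) i j"
proof
  assume "rel_class k (Suc i) j"
  then obtain g w where gw: "g \<in> chains k" "w \<in> chains (Suc k)" "kz g = rdif k w" "pr (Suc k) (Suc i) j w = w"
    and n: "\<forall>u\<in>chains (Suc k). rdif k w \<noteq> kz (rdif k u)"
    by (rule rel_classE)
  have w0: "w c {} = 0" for c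
    by (subst gw(4)[symmetric]) (simp add: pr_def)
  have "rdif k (kz w) = zc"
    using gw(3) kz_kz[of g] by (simp add: kz_rdif)
  then obtain w' where w': "w' \<in> chains (Suc (Suc k))" "rdif (Suc k) w' = kz w"
    using rdif_exact[OF chains_kz[OF gw(2)]] by blast
  have "\<not> (\<exists>u\<in>chains (Suc (Suc k)). kz w = kz (rdif (Suc k) u))"
  proof
    assume "\<exists>u\<in>chains (Suc (Suc k)). kz w = kz (rdif (Suc k) u)"
    then obtain u where u: "u \<in> chains (Suc (Suc k))" "kz w = kz (rdif (Suc k) u)" by blast
    \<comment> \<open>The Koszul differential never reads the value on the empty cell, so clearing
      it changes no boundary, and then \<open>dif2 w h\<close> has no constant term to obstruct
      Koszul exactness.\<close>
    define h where "h c s = (if s = {} then 0 else rdif (Suc k) u c s)" for c s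
    have h: "h \<in> chains (Suc k)"
      using chains_rdif[of "Suc k" u] by (auto simp: chains_def h_def)
    have "kz h = kz (rdif (Suc k) u)"
      by (intro ext) (simp add: kz_def koszul_eq h_def)
    then have 1: "kz (dif2 w h) = zc" using u by (simp add: kz_dif2 dif2_eq_zc)
    have "rdif k h c s = (if s = {} then 0 else rdif k (rdif (Suc k) u) c s)" for c s
      by (simp add: rdif_def[of k] h_def)
    then have 2: "rdif k h = zc" using rdif_rdif[OF u(1)] by (simp add: fun_eq_iff)
    obtain z where z: "z \<in> chains (Suc k)" "kz z = dif2 w h"
      using kz_exact[OF chains_dif2[OF gw(2) h] 1] w0 by (auto simp: dif2_def h_def)
    have "rdif k w = rdif k (dif2 w h)" by (simp add: rdif_dif2 2)
    also have "\<dots> = kz (rdif k z)" by (simp add: kz_rdif z)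
    finally show False using n z by blast
  qed
  then show "rel_class (Suc k) i j"
    unfolding rel_class_def using gw w'(1) w'(2)[symmetric] by (intro bexI[of _ w]) auto
next
  assume "rel_class (Suc k) i j"
  then obtain g w where g: "g \<in> chains (Suc k)" "pr (Suc k) (Suc i) j g = g" "w \<in> chains (Suc (Suc k))" "kz g = rdif (Suc k) w"
    and n: "\<not> (\<exists>w\<in>chains (Suc (Suc k)). kz g = kz (rdif (Suc k) w))"
    unfolding rel_class_def by auto
  \<comment> \<open>\<open>g\<close> lives on cells of size \<open>Suc i\<close>, hence not on the
    empty cell, where a constant term would obstruct exactness.\<close>
  have g0: "g c {} = 0" for c
    by (subst g(2)[symmetric]) (simp add: pr_def)
  have "kz (rdif k g) = zc" by (simp add: kz_rdif g rdif_rdif)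
  moreover have "lookup (rdif k g c {}) 0 = 0" for c by (simp add: rdif_def g0)
  ultimately obtain f where f: "f \<in> chains k" "kz f = rdif k g"
    using kz_exact[OF chains_rdif] by blast
  show "rel_class k (Suc i) j"
  proof (rule rel_classI[OF f(1) g(1) f(2) g(2)])
    fix u assume u: "u \<in> chains (Suc k)" "rdif k g = kz (rdif k u)"
    then have "rdif k (dif2 g (kz u)) = zc" by (simp add: rdif_dif2 kz_rdif dif2_eq_zc)
    then obtain h where h: "h \<in> chains (Suc (Suc k))" "rdif (Suc k) h = dif2 g (kz u)"
      using rdif_exact[OF chains_dif2[OF g(1) chains_kz[OF u(1)]]] by blast
    have "kz (rdif (Suc k) h) = kz g" by (simp add: h kz_dif2 kz_kz)
    then show False using n h by metis
  qed
qed

section \<open>Koszul position 0 and the complex over K\<close>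

definition cterm :: "(nat \<Rightarrow> 'v set \<Rightarrow> ('v, 'k) mpoly) \<Rightarrow> nat \<Rightarrow> 'k" where
  "cterm w = (\<lambda>b. lookup (w b {}) 0)"

definition cst :: "(nat \<Rightarrow> 'k) \<Rightarrow> nat \<Rightarrow> 'v set \<Rightarrow> ('v, 'k) mpoly" where
  "cst x = (\<lambda>b s. if s = {} then Poly_Mapping.single 0 (x b) else 0)"

lemma cterm_cst [simp]: "cterm (cst x) = x"
  by (simp add: cterm_def cst_def)

lemma cterm_kz [simp]: "cterm (kz x) = (\<lambda>_. 0)"
  by (simp add: cterm_def kz_def koszul_lookup_zero)

lemma cterm_dif2: "cterm (dif2 x y) = (\<lambda>b. cterm x b - cterm y b)"
  by (simp add: cterm_def dif2_def lookup_minus)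

lemma cterm_rdif: "cterm (rdif (Suc k) w) = tensor_differential F k (cterm w)"
  by (auto simp: cterm_def rdif_def tensor_differential_def lookup_sum lookup_mult_zero)

lemma cst_chains: "x \<in> tensor_K F k j \<Longrightarrow> cst x \<in> chains (Suc k)"
  by (auto simp: chains_def cst_def tensor_K_def fun_eq_iff) (metis not_le single_zero)

lemma pr_cst:
  assumes "x \<in> tensor_K F k j"
  shows "pr (Suc k) 0 j (cst x) = cst x"
proof (intro ext)
  fix b s
  have "hcomp (j - shift F k b) (Poly_Mapping.single 0 (x b)) = (Poly_Mapping.single 0 (x b) :: ('v, 'k) mpoly)"
  proof (cases "x b = 0")
    case False
    then have "shift F k b = j" using assms by (auto simp: tensor_K_def)
    then show ?thesis
      by (intro poly_mapping_eqI) (auto simp: hcomp_def lookup_filt lookup_single when_def total_deg_def)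
  qed simp
  then show "pr (Suc k) 0 j (cst x) b s = cst x b s"
    by (auto simp: pr_def cst_def)
qed

lemma cterm_tensor_K:
  assumes "w \<in> chains (Suc k)" "pr (Suc k) 0 j w = w"
  shows "cterm w \<in> tensor_K F k j"
  unfolding tensor_K_def
proof (intro CollectI allI impI conjI)
  fix b assume b: "cterm w b \<noteq> 0"
  show "b < rk F k"
  proof (rule ccontr)
    assume "\<not> b < rk F k"
    then show False using assms(1) b by (simp add: chains_def cterm_def)
  qed
  have "lookup (pr (Suc k) 0 j w b {}) 0 \<noteq> 0" using b assms(2) by (simp add: cterm_def)
  then have "int (total_deg (0 :: 'v \<Rightarrow>\<^sub>0 nat)) = j - shift F k b"
    by (auto simp: pr_def hcomp_def lookup_filt split: if_splits)
  then show "shift F k b = j" by (simp add: total_deg_def)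
qed

lemma tensor_boundaries_subset: "tensor_boundaries F i j \<subseteq> tensor_cycles F i j"
proof
  fix x assume "x \<in> tensor_boundaries F i j"
  then obtain y where y: "y \<in> tensor_K F (Suc i) j" and x: "x = tensor_differential F i y"
    by (auto simp: tensor_boundaries_def)
  have xe: "x = cterm (rdif (Suc i) (cst y))" by (simp add: cterm_rdif x)
  have "pr (Suc i) 0 j (rdif (Suc i) (cst y)) = rdif (Suc i) (cst y)"
    by (metis rdif_pr pr_cst y)
  then have K: "x \<in> tensor_K F i j"
    unfolding xe by (intro cterm_tensor_K) auto
  have "tensor_differential F l x = (\<lambda>_. 0)" if "i = Suc l" for l
  proof -
    have "tensor_differential F l x = cterm (rdif (Suc l) (rdif (Suc i) (cst y)))"
      by (simp add: xe cterm_rdif)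
    also have "\<dots> = (\<lambda>_. 0)" using rdif_rdif[OF cst_chains[OF y]] that by (simp add: cterm_def)
    finally show ?thesis .
  qed
  then show "x \<in> tensor_cycles F i j" using K by (auto simp: tensor_cycles_def split: nat.splits)
qed

lemma kz_concentrated:
  assumes "\<And>c s. s \<noteq> {} \<Longrightarrow> x c s = 0"
  shows "kz x = zc"
  using assms by (intro ext) (simp add: kz_def koszul_eq)

text \<open>Koszul boundaries on the empty cell are exactly the polynomials without constant term.
  So reducing modulo the variables and working modulo Koszul boundaries coincide there, and both
  notions ask for the same cycles modulo row boundaries.\<close>

lemma tensor_homology_iff: "tensor_cycles F i j \<noteq> tensor_boundaries F i j \<longleftrightarrow> rel_class i 0 j"
proof
  assume "tensor_cycles F i j \<noteq> tensor_boundaries F i j"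
  then obtain x where x: "x \<in> tensor_cycles F i j" "x \<notin> tensor_boundaries F i j"
    using tensor_boundaries_subset by blast
  then have K: "x \<in> tensor_K F i j" by (auto simp: tensor_cycles_def split: nat.splits)
  let ?X = "cst x"
  \<comment> \<open>For \<open>i = 0\<close> the constant term vanishes because values of the
    augmentation lie in \<open>M\<close>; afterwards this is the cycle condition on
    \<open>x\<close>.\<close>
  have "lookup (rdif i ?X c {}) 0 = 0" for c
  proof (cases i)
    case 0
    have "augmentation F (\<lambda>b. ?X b {}) \<in> M"
      using res free_mod_chains[OF cst_chains[OF K]] 0 unfolding graded_free_resolution_def by blast
    then show ?thesis using M_const 0 by (simp add: rdif_0_chains)
  next
    case (Suc l)
    then have "cterm (rdif i ?X) = (\<lambda>_. 0)" using x(1) by (simp add: tensor_cycles_def cterm_rdif)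
    then show ?thesis by (simp add: cterm_def fun_eq_iff)
  qed
  moreover have "kz (rdif i ?X) = zc"
    by (rule kz_concentrated) (simp add: rdif_def cst_def)
  ultimately obtain g where g: "g \<in> chains i" "kz g = rdif i ?X"
    using kz_exact[OF chains_rdif] by blast
  show "rel_class i 0 j"
  proof (rule rel_classI[OF g(1) cst_chains[OF K] g(2) pr_cst[OF K]])
    fix u assume u: "u \<in> chains (Suc i)" "rdif i ?X = kz (rdif i u)"
    then have "rdif i (dif2 ?X (kz u)) = zc" by (simp add: rdif_dif2 kz_rdif dif2_eq_zc)
    then obtain Y where Y: "Y \<in> chains (Suc (Suc i))" "rdif (Suc i) Y = dif2 ?X (kz u)"
      using rdif_exact[OF chains_dif2[OF cst_chains[OF K] chains_kz[OF u(1)]]] by blast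
    \<comment> \<open>Only the degree \<open>j\<close> part of \<open>Y\<close> reduces to an
      element of \<open>tensor_K F (Suc i) j\<close>. It still hits \<open>x\<close>, because Koszul
      boundaries have no constant terms.\<close>
    let ?Y = "pr (Suc (Suc i)) 0 j Y"
    have "rdif (Suc i) ?Y = pr (Suc i) 0 j (dif2 ?X (kz u))" by (simp add: rdif_pr Y)
    also have "\<dots> = dif2 (pr (Suc i) 0 j ?X) (pr (Suc i) 0 j (kz u))"
      by (intro ext) (auto simp: pr_def dif2_def hcomp_def lookup_filt lookup_minus intro!: poly_mapping_eqI)
    also have "\<dots> = dif2 ?X (kz (pr (Suc i) (Suc 0) j u))"
      by (simp only: pr_cst[OF K] kz_pr)
    finally have "cterm (rdif (Suc i) ?Y) = x" by (simp add: cterm_dif2)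
    then have "x = tensor_differential F i (cterm ?Y)" by (simp add: cterm_rdif)
    moreover have "cterm ?Y \<in> tensor_K F (Suc i) j"
      using Y(1) by (intro cterm_tensor_K) (auto simp: chains_pr)
    ultimately show False using x(2) by (auto simp: tensor_boundaries_def)
  qed
next
  assume "rel_class i 0 j"
  then obtain g w where gw: "g \<in> chains i" "w \<in> chains (Suc i)" "kz g = rdif i w" "pr (Suc i) 0 j w = w"
    and n: "\<forall>u\<in>chains (Suc i). rdif i w \<noteq> kz (rdif i u)"
    by (rule rel_classE)
  have K: "cterm w \<in> tensor_K F i j" using gw by (intro cterm_tensor_K)
  have "tensor_differential F l (cterm w) = (\<lambda>_. 0)" if "i = Suc l" for l
  proof -
    have "tensor_differential F l (cterm w) = cterm (kz g)" using gw(3) that by (simp add: cterm_rdif)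
    then show ?thesis by simp
  qed
  then have "cterm w \<in> tensor_cycles F i j" using K by (auto simp: tensor_cycles_def split: nat.splits)
  moreover have "cterm w \<notin> tensor_boundaries F i j"
  proof
    assume "cterm w \<in> tensor_boundaries F i j"
    then obtain y where y: "y \<in> tensor_K F (Suc i) j" "cterm w = tensor_differential F i y"
      by (auto simp: tensor_boundaries_def)
    let ?y = "rdif (Suc i) (cst y)"
    \<comment> \<open>Minus the row boundary, \<open>w\<close> lives on the empty cell only and has
      no constant terms there, so it is a Koszul boundary.\<close>
    let ?z = "dif2 w ?y"
    have "cterm ?y = cterm w" by (simp add: cterm_rdif y)
    then have z0: "lookup (?z c {}) 0 = 0" for c
      by (simp add: cterm_def dif2_def lookup_minus fun_eq_iff)
    have "w c s = 0" if "s \<noteq> {}" for c s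
      by (subst gw(4)[symmetric]) (use that in \<open>simp add: pr_def\<close>)
    then have "kz ?z = zc"
      by (intro kz_concentrated) (simp add: dif2_def rdif_def cst_def)
    then obtain u where u: "u \<in> chains (Suc i)" "kz u = ?z"
      using kz_exact[OF chains_dif2[OF gw(2) chains_rdif]] z0 by blast
    have "rdif i w = rdif i ?z" using rdif_rdif[OF cst_chains[OF y(1)]] by (simp add: rdif_dif2)
    also have "\<dots> = kz (rdif i u)" by (simp add: kz_rdif u)
    finally show False using n u by blast
  qed
  ultimately show "tensor_cycles F i j \<noteq> tensor_boundaries F i j" by blast
qed

text \<open>Position 0 is S with a single basis element, and the image of \<open>rdif 0\<close>
  consists of the chains with values in \<open>M\<close>; \<open>emb\<close> makes this
  identification.\<close>

lemma rel_class_0: "rel_class 0 i j \<longleftrightarrow> koszul_Tor M i j"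
proof -
  have M: "augmentation F ` free_mod F 0 = M"
    using res unfolding graded_free_resolution_def by blast
  define emb :: "('v set \<Rightarrow> ('v, 'k) mpoly) \<Rightarrow> nat \<Rightarrow> 'v set \<Rightarrow> ('v, 'k) mpoly"
    where "emb f = (\<lambda>c. if c = 0 then f else (\<lambda>_. 0))" for f
  have emb: "emb f \<in> chains 0" for f by (simp add: chains_def emb_def)
  have emb': "g = emb (g 0)" if "g \<in> chains 0" for g
    using that by (auto simp: chains_def fun_eq_iff emb_def)
  have kzemb: "kz (emb f) = emb (koszul f)" for f
    by (intro ext) (simp add: kz_def emb_def)
  have lift: "(\<exists>w\<in>chains (Suc 0). rdif 0 w = emb f) \<longleftrightarrow> (\<forall>s. f s \<in> M)" for f
  proof
    assume "\<exists>w\<in>chains (Suc 0). rdif 0 w = emb f"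
    then obtain w where w: "w \<in> chains (Suc 0)" "rdif 0 w = emb f" by blast
    show "\<forall>s. f s \<in> M"
    proof
      fix s
      have "f s = rdif 0 w 0 s" by (simp add: w emb_def)
      also have "\<dots> = augmentation F (\<lambda>b. w b s)" by (simp add: rdif_0_chains)
      finally show "f s \<in> M" using M free_mod_chains[OF w(1)] by blast
    qed
  next
    assume "\<forall>s. f s \<in> M"
    then have "\<forall>s. \<exists>z. z \<in> free_mod F 0 \<and> augmentation F z = f s" using M by (metis imageE)
    then obtain z where z: "\<And>s. z s \<in> free_mod F 0" "\<And>s. augmentation F (z s) = f s" by metis
    have "(\<lambda>b s. z s b) \<in> chains (Suc 0)" using z(1) by (auto simp: chains_def free_mod_def)
    moreover have "rdif 0 (\<lambda>b s. z s b) = emb f"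
      by (intro ext) (simp add: rdif_0_chains z emb_def)
    ultimately show "\<exists>w\<in>chains (Suc 0). rdif 0 w = emb f" by blast
  qed
  have pure: "pr 0 (Suc i) j (emb f) = emb f \<longleftrightarrow>
     (\<forall>s. card s \<noteq> Suc i \<longrightarrow> f s = 0) \<and> (\<forall>s. homogeneous (j - int (Suc i)) (f s))" (is "?l \<longleftrightarrow> ?r") for f
  proof -
    have "?l \<longleftrightarrow> (\<forall>s. (if card s = Suc i then hcomp (j - int (Suc i)) (f s) else 0) = f s)"
      by (auto simp: pr_def fun_eq_iff emb_def)
    also have "\<dots> \<longleftrightarrow> ?r"
      unfolding homogeneous_iff_hcomp by (metis hcomp_zero)
    finally show ?thesis .
  qed
  have "rel_class 0 i j \<longleftrightarrow> (\<exists>f. pr 0 (Suc i) j (emb f) = emb f \<and> (\<exists>w\<in>chains (Suc 0). kz (emb f) = rdif 0 w) \<and>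
     \<not> (\<exists>w\<in>chains (Suc 0). kz (emb f) = kz (rdif 0 w)))"
    unfolding rel_class_def by (auto simp: emb) (metis emb')
  also have "\<dots> \<longleftrightarrow> koszul_Tor M i j"
  proof -
    have 1: "(\<exists>w\<in>chains (Suc 0). kz (emb f) = rdif 0 w) \<longleftrightarrow> (\<forall>s. koszul f s \<in> M)" for f
      unfolding kzemb using lift[of "koszul f"] by metis
    have 2: "(\<exists>w\<in>chains (Suc 0). kz (emb f) = kz (rdif 0 w)) \<longleftrightarrow> (\<exists>h. (\<forall>s. h s \<in> M) \<and> koszul h = koszul f)" for f
    proof
      assume "\<exists>w\<in>chains (Suc 0). kz (emb f) = kz (rdif 0 w)"
      then obtain w where w: "w \<in> chains (Suc 0)" "kz (emb f) = kz (rdif 0 w)" by blast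
      have e: "rdif 0 w = emb (rdif 0 w 0)" by (rule emb') simp
      then have "\<forall>s. rdif 0 w 0 s \<in> M" using lift w(1) by metis
      moreover have "koszul (rdif 0 w 0) = koszul f"
        using fun_cong[OF w(2), of 0] by (simp add: kz_def emb_def)
      ultimately show "\<exists>h. (\<forall>s. h s \<in> M) \<and> koszul h = koszul f" by blast
    next
      assume "\<exists>h. (\<forall>s. h s \<in> M) \<and> koszul h = koszul f"
      then obtain h where h: "\<forall>s. h s \<in> M" "koszul h = koszul f" by blast
      then obtain w where w: "w \<in> chains (Suc 0)" "rdif 0 w = emb h" using lift by metis
      have "kz (emb f) = kz (rdif 0 w)" by (simp only: w kzemb h)
      then show "\<exists>w\<in>chains (Suc 0). kz (emb f) = kz (rdif 0 w)" using w(1) by blast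
    qed
    show ?thesis unfolding koszul_Tor_def pure 1 2 by (simp add: conj_assoc)
  qed
  finally show ?thesis .
qed

theorem tensor_homology_iff_koszul_Tor:
  "tensor_cycles F i j \<noteq> tensor_boundaries F i j \<longleftrightarrow> koszul_Tor M i j"
proof -
  \<comment> \<open>Each shift trades a Koszul position for a step in the resolution, leading from
    (0, i), which sees only \<open>M\<close>, to (i, 0), which sees the homology of F tensored with
    K.\<close>
  have "rel_class k i j \<longleftrightarrow> rel_class (k + i) 0 j" for k
    by (induction i arbitrary: k) (simp_all add: rel_class_shift)
  from this[of 0] show ?thesis by (simp add: tensor_homology_iff rel_class_0)
qed

end

subsection \<open>The Taylor resolution of a squarefree monomial ideal\<close>

text \<open>Membership depends only on the supports of the occurring monomials, so ideal membership
  becomes set inclusion; \<open>ideal_gen_sqmono\<close> identifies this set with the generated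
  ideal.\<close>

definition sqf_ideal :: "'v::finite set set \<Rightarrow> ('v, 'k::field) mpoly set" where
  "sqf_ideal G = {p. \<forall>m\<in>keys p. \<exists>g\<in>G. g \<subseteq> keys m}"

lemma sqf_ideal_zero: "0 \<in> sqf_ideal G"
  by (simp add: sqf_ideal_def)

lemma sqf_ideal_add: "p \<in> sqf_ideal G \<Longrightarrow> q \<in> sqf_ideal G \<Longrightarrow> p + q \<in> sqf_ideal G"
  using keys_add[of p q] by (auto simp: sqf_ideal_def)

lemma sqf_ideal_mult: "p \<in> sqf_ideal G \<Longrightarrow> q * p \<in> sqf_ideal G"
  unfolding sqf_ideal_def
proof (intro CollectI ballI)
  fix m assume p: "p \<in> {p. \<forall>m\<in>keys p. \<exists>g\<in>G. g \<subseteq> keys m}" and "m \<in> keys (q * p)"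
  then obtain a b where "b \<in> keys p" "m = a + b" using keys_mult[of q p] by blast
  moreover from this obtain g where "g \<in> G" "g \<subseteq> keys b" using p by blast
  ultimately show "\<exists>g\<in>G. g \<subseteq> keys m" by (intro bexI[of _ g]) (auto simp: keys_add_monom)
qed

lemma sqf_ideal_sum: "(\<And>x. x \<in> A \<Longrightarrow> f x \<in> sqf_ideal G) \<Longrightarrow> sum f A \<in> sqf_ideal G"
  by (induction A rule: infinite_finite_induct) (auto simp: sqf_ideal_zero sqf_ideal_add)

lemma sqmono_in_sqf_ideal: "g \<in> G \<Longrightarrow> g \<subseteq> s \<Longrightarrow> sqmono s \<in> sqf_ideal G"
  by (auto simp: sqf_ideal_def sqmono_def)

lemma sum_monomials: "(\<Sum>m\<in>keys p. Poly_Mapping.single m (lookup p m)) = p"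
  by (rule poly_mapping_eqI) (auto simp: lookup_sum lookup_single when_def in_keys_iff sum.delta)

lemma sqf_ideal_const:
  assumes "{} \<notin> G" "p \<in> sqf_ideal G"
  shows "lookup p 0 = 0"
proof (rule ccontr)
  assume "lookup p 0 \<noteq> 0"
  then have "0 \<in> keys p" by (simp add: in_keys_iff)
  then show False using assms by (auto simp: sqf_ideal_def)
qed

lemma ideal_gen_sqmono: "ideal_gen (sqmono ` G) = (sqf_ideal G :: ('v::finite, 'k::field) mpoly set)"
proof
  have "module.subspace (*) (sqf_ideal G :: ('v, 'k) mpoly set)"
    unfolding module.subspace_def[OF module_times]
    by (intro conjI ballI allI sqf_ideal_zero sqf_ideal_add sqf_ideal_mult)
  then show "ideal_gen (sqmono ` G) \<subseteq> (sqf_ideal G :: ('v, 'k) mpoly set)"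
    unfolding ideal_gen_def
    by (intro module.span_minimal[OF module_times] image_subsetI sqmono_in_sqf_ideal[OF _ subset_refl])
  show "(sqf_ideal G :: ('v, 'k) mpoly set) \<subseteq> ideal_gen (sqmono ` G)"
  proof
    fix p :: "('v, 'k) mpoly"
    assume p: "p \<in> sqf_ideal G"
    have "Poly_Mapping.single m (lookup p m) \<in> module.span (*) (sqmono ` G)" if m: "m \<in> keys p" for m
    proof -
      obtain g where g: "g \<in> G" "g \<subseteq> keys m" using p m by (auto simp: sqf_ideal_def)
      have "Poly_Mapping.single m (lookup p m) = Poly_Mapping.single (m - indm g) (lookup p m) * sqmono g"
        by (simp add: sqmono_def mult_single minus_add_indm g)
      moreover have "sqmono g \<in> module.span (*) (sqmono ` G :: ('v, 'k) mpoly set)"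
        using g by (intro module.span_base[OF module_times] imageI)
      ultimately show ?thesis by (simp only: module.span_scale[OF module_times])
    qed
    then have "(\<Sum>m\<in>keys p. Poly_Mapping.single m (lookup p m)) \<in> module.span (*) (sqmono ` G)"
      by (rule module.span_sum[OF module_times])
    then show "p \<in> ideal_gen (sqmono ` G)" by (simp add: sum_monomials ideal_gen_def)
  qed
qed

context
  fixes G :: "'v::finite set set"
begin

text \<open>Single generators form position 0; the empty cell carries S itself, the target of the
  augmentation.\<close>

definition cells :: "nat \<Rightarrow> 'v set set set" where
  "cells i = {s. s \<subseteq> G \<and> card s = Suc i}"

definition cell_enum :: "nat \<Rightarrow> nat \<Rightarrow> 'v set set" where
  "cell_enum i = (SOME f. bij_betw f {0..<card (cells i)} (cells i))"

text \<open>An entry of \<open>dif\<close> has at most one nonzero summand, for the generator whose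
  removal turns cell \<open>b\<close> into cell \<open>c\<close>. In the form of a sum it becomes
  \<open>tbd\<close> once the two summations are exchanged.\<close>

definition taylor :: "('v, 'k::field) free_complex" where
  "taylor =
    \<lparr>rk = (\<lambda>i. card (cells i)),
     shift = (\<lambda>i b. int (card (\<Union>(cell_enum i b)))),
     dif = (\<lambda>i b c. \<Sum>v\<in>-cell_enum i c. if insert v (cell_enum i c) = cell_enum (Suc i) b
        then sg v (cell_enum i c) * sqmono (v - \<Union>(cell_enum i c)) else 0),
     aug = (\<lambda>b. sqmono (\<Union>(cell_enum 0 b)))\<rparr>"

abbreviation tbd :: "('v set set \<Rightarrow> ('v, 'k::field) mpoly) \<Rightarrow> 'v set set \<Rightarrow> ('v, 'k) mpoly" where
  "tbd \<equiv> simplex_bd (lcm_mult (\<lambda>g. g))"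

definition to_cells :: "nat \<Rightarrow> (nat \<Rightarrow> ('v, 'k::field) mpoly) \<Rightarrow> 'v set set \<Rightarrow> ('v, 'k) mpoly" where
  "to_cells i x s = (\<Sum>b<card (cells i). if cell_enum i b = s then x b else 0)"

definition of_cells :: "nat \<Rightarrow> ('v set set \<Rightarrow> ('v, 'k::field) mpoly) \<Rightarrow> nat \<Rightarrow> ('v, 'k) mpoly" where
  "of_cells i f = (\<lambda>b. if b < card (cells i) then f (cell_enum i b) else 0)"

lemma cell_enum_bij: "bij_betw (cell_enum i) {0..<card (cells i)} (cells i)"
  unfolding cell_enum_def by (rule someI_ex[OF ex_bij_betw_nat_finite]) simp

lemma cell_enum_in: "b < card (cells i) \<Longrightarrow> cell_enum i b \<in> cells i"
  using bij_betw_apply[OF cell_enum_bij, of b i] by simp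

lemma cell_enum_eq_iff:
  "b < card (cells i) \<Longrightarrow> c < card (cells i) \<Longrightarrow> cell_enum i b = cell_enum i c \<longleftrightarrow> b = c"
  using bij_betw_imp_inj_on[OF cell_enum_bij, of i] by (simp add: inj_on_eq_iff)

lemma cell_enum_ex: "s \<in> cells i \<Longrightarrow> \<exists>b<card (cells i). cell_enum i b = s"
proof -
  assume "s \<in> cells i"
  then have "s \<in> cell_enum i ` {0..<card (cells i)}"
    by (simp only: bij_betw_imp_surj_on[OF cell_enum_bij])
  then show ?thesis by force
qed

lemma to_cells_enum: "b < card (cells i) \<Longrightarrow> to_cells i x (cell_enum i b) = x b"
proof -
  assume b: "b < card (cells i)"
  have "to_cells i x (cell_enum i b) = (\<Sum>c<card (cells i). if c = b then x c else 0)"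
    unfolding to_cells_def by (rule sum.cong) (use b cell_enum_eq_iff in auto)
  then show ?thesis using b by simp
qed

lemma to_cells_outside: "s \<notin> cells i \<Longrightarrow> to_cells i x s = 0"
  unfolding to_cells_def by (rule sum.neutral) (auto dest: cell_enum_in)

lemma of_to_cells: "x \<in> free_mod taylor i \<Longrightarrow> of_cells i (to_cells i x) = x"
  by (auto simp: of_cells_def to_cells_enum free_mod_def taylor_def fun_eq_iff)

lemma to_of_cells:
  assumes "\<And>s. s \<notin> cells i \<Longrightarrow> f s = 0"
  shows "to_cells i (of_cells i f) = f"
proof
  fix s
  show "to_cells i (of_cells i f) s = f s"
  proof (cases "s \<in> cells i")
    case True
    then obtain b where "b < card (cells i)" "cell_enum i b = s" using cell_enum_ex by blast
    then show ?thesis using to_cells_enum[of b i "of_cells i f"] by (simp add: of_cells_def)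
  qed (simp add: assms to_cells_outside)
qed

lemma of_cells_free_mod: "of_cells i f \<in> free_mod taylor i"
  by (simp add: of_cells_def free_mod_def taylor_def)

lemma tbd_eq: "tbd f t = (\<Sum>v\<in>-t. sg v t * (sqmono (v - \<Union>t) * f (insert v t)))"
  by (simp add: simplex_bd_def lcm_mult_def)

lemma differential_taylor: "differential taylor i x = of_cells i (tbd (to_cells (Suc i) x))"
proof
  fix c
  let ?t = "cell_enum i c"
  have "(\<Sum>b<card (cells (Suc i)). x b * (\<Sum>v\<in>-?t. if insert v ?t = cell_enum (Suc i) b
        then sg v ?t * sqmono (v - \<Union>?t) else 0)) =
    (\<Sum>b<card (cells (Suc i)). \<Sum>v\<in>-?t. sg v ?t * (sqmono (v - \<Union>?t) * (if cell_enum (Suc i) b = insert v ?t then x b else 0)))"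
    by (auto simp: sum_distrib_left mult_ac intro!: sum.cong)
  also have "\<dots> = (\<Sum>v\<in>-?t. \<Sum>b<card (cells (Suc i)). sg v ?t * (sqmono (v - \<Union>?t) * (if cell_enum (Suc i) b = insert v ?t then x b else 0)))"
    by (rule sum.swap)
  also have "\<dots> = tbd (to_cells (Suc i) x) ?t"
    by (simp only: tbd_eq to_cells_def sum_distrib_left)
  finally show "differential taylor i x c = of_cells i (tbd (to_cells (Suc i) x)) c"
    by (simp add: differential_def taylor_def of_cells_def)
qed

lemma tbd_cells:
  assumes "\<And>s. s \<notin> cells (Suc i) \<Longrightarrow> f s = 0" and "t \<notin> cells i"
  shows "tbd f t = 0"
  unfolding tbd_eq
proof (rule sum.neutral, intro ballI)
  fix v assume "v \<in> -t"
  then have "insert v t \<notin> cells (Suc i)" using assms(2) by (auto simp: cells_def)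
  then show "sg v t * (sqmono (v - \<Union>t) * f (insert v t)) = 0" using assms(1) by simp
qed

lemma to_cells_differential: "to_cells i (differential taylor i x) = tbd (to_cells (Suc i) x)"
  unfolding differential_taylor by (rule to_of_cells) (auto intro!: tbd_cells to_cells_outside)

lemma augmentation_taylor: "augmentation taylor x = tbd (to_cells 0 x) {}"
proof -
  have "tbd (to_cells 0 x) {} = (\<Sum>v\<in>UNIV. sqmono v * to_cells 0 x {v})"
    by (simp add: tbd_eq sg_def)
  also have "\<dots> = (\<Sum>v\<in>UNIV. \<Sum>b<card (cells 0). if cell_enum 0 b = {v} then x b * sqmono v else 0)"
    by (auto simp: to_cells_def sum_distrib_left mult.commute intro!: sum.cong)
  also have "\<dots> = (\<Sum>b<card (cells 0). \<Sum>v\<in>UNIV. if cell_enum 0 b = {v} then x b * sqmono v else 0)"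
    by (rule sum.swap)
  also have "\<dots> = (\<Sum>b<card (cells 0). x b * sqmono (\<Union>(cell_enum 0 b)))"
  proof (rule sum.cong)
    fix b assume "b \<in> {..<card (cells 0)}"
    then have "cell_enum 0 b \<in> cells 0" by (simp add: cell_enum_in)
    then obtain w where "cell_enum 0 b = {w}" by (auto simp: cells_def card_Suc_eq)
    then show "(\<Sum>v\<in>UNIV. if cell_enum 0 b = {v} then x b * sqmono v else 0) = x b * sqmono (\<Union>(cell_enum 0 b))"
      by simp
  qed simp
  finally show ?thesis by (simp add: augmentation_def taylor_def)
qed

lemma tbd_tbd: "tbd (tbd f) t = (0 :: ('v, 'k::field) mpoly)"
proof -
  interpret simplex_complex "lcm_mult (\<lambda>g. g) :: _ \<Rightarrow> _ \<Rightarrow> ('v, 'k) mpoly \<Rightarrow> _"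
    "\<lambda>v t. qdiv (\<lambda>_. True) (v - \<Union>((\<lambda>g. g) ` t))"
    "\<lambda>s. if s \<subseteq> UNIV then UNIV else {0}" UNIV
    "\<lambda>v s m. v \<in> s \<or> v - \<Union>((\<lambda>g. g) ` s) \<subseteq> keys m"
    by (rule simplex_complex_lcm)
  show ?thesis by (rule bd_bd)
qed

text \<open>Acyclicity yields a preimage spread over cells of all sizes. Keeping only its cells with
  \<open>Suc i\<close> generators does not affect the boundary on cells of size \<open>i\<close>,
  and on other sizes both sides vanish.\<close>

lemma taylor_lift:
  fixes f :: "'v set set \<Rightarrow> ('v, 'k::field) mpoly"
  assumes supp: "\<And>s. \<not> s \<subseteq> G \<Longrightarrow> f s = 0" "\<And>s. card s \<noteq> i \<Longrightarrow> f s = 0"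
    and cyc: "tbd f = (\<lambda>_. 0)"
    and f0: "\<And>m. m \<in> keys (f {}) \<Longrightarrow> \<exists>g\<in>G. g \<subseteq> keys m"
  shows "\<exists>y\<in>free_mod taylor i. tbd (to_cells i y) = f"
proof -
  obtain u where u: "\<And>s. \<not> s \<subseteq> G \<Longrightarrow> u s = 0" "tbd u = f"
    using lcm_complex_acyclic[of G f "\<lambda>g. g", OF supp(1) cyc f0] by blast
  define w where "w s = (if s \<in> cells i then u s else 0)" for s
  have "tbd w t = f t" for t
  proof (cases "card t = i")
    case True
    have "tbd w t = tbd u t"
      unfolding tbd_eq
    proof (rule sum.cong)
      fix v assume "v \<in> -t"
      then have "w (insert v t) = u (insert v t)"
        using True u(1) by (auto simp: w_def cells_def)
      then show "sg v t * (sqmono (v - \<Union>t) * w (insert v t)) = sg v t * (sqmono (v - \<Union>t) * u (insert v t))" by simp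
    qed simp
    then show ?thesis using u by simp
  next
    case False
    have "tbd w t = 0"
      unfolding tbd_eq by (rule sum.neutral) (use False in \<open>auto simp: w_def cells_def\<close>)
    then show ?thesis using False supp by simp
  qed
  moreover have "to_cells i (of_cells i w) = w" by (rule to_of_cells) (simp add: w_def)
  ultimately show ?thesis
    by (intro bexI[of _ "of_cells i w"]) (auto simp: of_cells_free_mod)
qed

lemma homogeneous_sum: "(\<And>x. x \<in> A \<Longrightarrow> homogeneous d (f x)) \<Longrightarrow> homogeneous d (sum f A :: ('v, 'k::field) mpoly)"
  by (simp add: homogeneous_iff_hcomp hcomp_sum)

lemma homogeneous_sg: "homogeneous d p \<Longrightarrow> homogeneous d (sg v s * p :: ('v, 'k::field) mpoly)"
  using sg_cases[of v s, where 'r = "('v, 'k) mpoly"] by (auto simp: homogeneous_def)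

theorem taylor_resolution: "graded_free_resolution taylor (sqf_ideal G :: ('v, 'k::field) mpoly set)"
  unfolding graded_free_resolution_def
proof (intro conjI allI impI)
  let ?T = "taylor :: ('v, 'k) free_complex"
  fix b assume "b < rk ?T 0"
  show "homogeneous (shift ?T 0 b) (aug ?T b)"
    by (simp add: taylor_def homogeneous_sqmono)
next
  let ?T = "taylor :: ('v, 'k) free_complex"
  fix i b c
  let ?t = "cell_enum i c"
  have "homogeneous (int (card (\<Union>(cell_enum (Suc i) b))) - int (card (\<Union>?t)))
     (if insert v ?t = cell_enum (Suc i) b then sg v ?t * sqmono (v - \<Union>?t) else 0 :: ('v, 'k) mpoly)" for v
  proof (cases "insert v ?t = cell_enum (Suc i) b")
    case True
    have "\<Union>(cell_enum (Suc i) b) = \<Union>?t \<union> (v - \<Union>?t)" using True by auto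
    moreover have "card (\<Union>?t \<union> (v - \<Union>?t)) = card (\<Union>?t) + card (v - \<Union>?t)"
      by (rule card_Un_disjoint) auto
    ultimately have "int (card (\<Union>(cell_enum (Suc i) b))) - int (card (\<Union>?t)) = int (card (v - \<Union>?t))" by simp
    then show ?thesis using True by (simp add: homogeneous_sg homogeneous_sqmono)
  qed (simp add: homogeneous_def)
  then show "homogeneous (shift ?T (Suc i) b - shift ?T i c) (dif ?T i b c)"
    unfolding taylor_def by (simp add: homogeneous_sum)
next
  let ?T = "taylor :: ('v, 'k) free_complex"
  show "augmentation ?T ` free_mod ?T 0 = sqf_ideal G"
  proof
    show "augmentation ?T ` free_mod ?T 0 \<subseteq> sqf_ideal G"
    proof clarify
      fix x :: "nat \<Rightarrow> ('v, 'k) mpoly"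
      have "sqmono (\<Union>(cell_enum 0 b)) \<in> (sqf_ideal G :: ('v, 'k) mpoly set)" if "b < card (cells 0)" for b
      proof -
        have "cell_enum 0 b \<in> cells 0" using that by (rule cell_enum_in)
        then obtain w where "cell_enum 0 b = {w}" "w \<in> G" by (auto simp: cells_def card_Suc_eq)
        then show ?thesis by (auto intro: sqmono_in_sqf_ideal)
      qed
      then show "augmentation ?T x \<in> sqf_ideal G"
        by (auto simp: augmentation_def taylor_def intro!: sqf_ideal_sum sqf_ideal_mult)
    qed
    show "sqf_ideal G \<subseteq> augmentation ?T ` free_mod ?T 0"
    proof
      fix p :: "('v, 'k) mpoly" assume p: "p \<in> sqf_ideal G"
      \<comment> \<open>Viewed as a chain on the empty cell, \<open>p\<close> makes surjectivity of
        the augmentation another case of the acyclicity.\<close>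
      define f where "f s = (if s = {} then p else 0)" for s :: "'v set set"
      have "\<exists>y\<in>free_mod ?T 0. tbd (to_cells 0 y) = f"
      proof (rule taylor_lift)
        show "tbd f = (\<lambda>_. 0)" by (auto simp: tbd_eq f_def)
      qed (use p in \<open>auto simp: f_def sqf_ideal_def\<close>)
      then obtain y where "y \<in> free_mod ?T 0" "tbd (to_cells 0 y) = f" by blast
      then show "p \<in> augmentation ?T ` free_mod ?T 0"
        by (intro image_eqI[of _ _ y]) (auto simp: augmentation_taylor f_def)
    qed
  qed
next
  let ?T = "taylor :: ('v, 'k) free_complex"
  have L: "\<exists>y\<in>free_mod ?T (Suc i). differential ?T i y = x"
    if x: "x \<in> free_mod ?T i" and c: "tbd (to_cells i x) = (\<lambda>_. 0)" for i x
  proof -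
    have "\<exists>y\<in>free_mod ?T (Suc i). tbd (to_cells (Suc i) y) = to_cells i x"
      by (rule taylor_lift) (use c in \<open>auto intro!: to_cells_outside simp: cells_def to_cells_outside\<close>)
    then obtain y where "y \<in> free_mod ?T (Suc i)" "tbd (to_cells (Suc i) y) = to_cells i x" by blast
    then show ?thesis
      by (intro bexI[of _ y]) (simp_all add: differential_taylor of_to_cells[OF x])
  qed
  have fm: "differential ?T i y \<in> free_mod ?T i" for i y
    by (simp add: differential_taylor of_cells_free_mod)
  show "{x \<in> free_mod ?T 0. augmentation ?T x = 0} = differential ?T 0 ` free_mod ?T (Suc 0)"
  proof (intro equalityI subsetI)
    fix x assume "x \<in> {x \<in> free_mod ?T 0. augmentation ?T x = 0}"
    then have x: "x \<in> free_mod ?T 0" "augmentation ?T x = 0" by auto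
    have "tbd (to_cells 0 x) t = 0" for t
    proof (cases "t = {}")
      case True
      then show ?thesis using x by (simp add: augmentation_taylor)
    next
      case False
      show ?thesis
        unfolding tbd_eq
      proof (rule sum.neutral, intro ballI)
        fix v assume "v \<in> -t"
        then have "insert v t \<notin> cells 0" using False by (auto simp: cells_def)
        then show "sg v t * (sqmono (v - \<Union>t) * to_cells 0 x (insert v t)) = 0"
          by (simp add: to_cells_outside)
      qed
    qed
    then have "tbd (to_cells 0 x) = (\<lambda>_. 0)" by auto
    then show "x \<in> differential ?T 0 ` free_mod ?T (Suc 0)" using L[OF x(1)] by blast
  next
    fix x assume "x \<in> differential ?T 0 ` free_mod ?T (Suc 0)"
    then show "x \<in> {x \<in> free_mod ?T 0. augmentation ?T x = 0}"
      by (auto simp: fm augmentation_taylor to_cells_differential tbd_tbd)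
  qed
  fix i
  show "{x \<in> free_mod ?T (Suc i). differential ?T i x = (\<lambda>_. 0)} =
    differential ?T (Suc i) ` free_mod ?T (Suc (Suc i))"
  proof (intro equalityI subsetI)
    fix x assume "x \<in> {x \<in> free_mod ?T (Suc i). differential ?T i x = (\<lambda>_. 0)}"
    then have x: "x \<in> free_mod ?T (Suc i)" "differential ?T i x = (\<lambda>_. 0)" by auto
    have "tbd (to_cells (Suc i) x) = to_cells i (\<lambda>_. 0)"
      using to_cells_differential[of i x] x by simp
    also have "\<dots> = (\<lambda>_. 0)" by (auto simp: to_cells_def)
    finally show "x \<in> differential ?T (Suc i) ` free_mod ?T (Suc (Suc i))" using L[OF x(1)] by blast
  next
    fix x assume "x \<in> differential ?T (Suc i) ` free_mod ?T (Suc (Suc i))"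
    then show "x \<in> {x \<in> free_mod ?T (Suc i). differential ?T i x = (\<lambda>_. 0)}"
      by (auto simp: fm differential_taylor[of i] to_cells_differential tbd_tbd of_cells_def)
  qed
qed

end

text \<open>Every resolution yields the right-hand side, which settles one direction; the other
  needs some resolution to exist, and \<open>taylor\<close> is one.\<close>

lemma Tor_nonzero_iff_koszul_Tor:
  assumes "{} \<notin> G"
  shows "Tor_nonzero (sqf_ideal G :: ('v::finite, 'k::field) mpoly set) i j \<longleftrightarrow> koszul_Tor (sqf_ideal G :: ('v, 'k) mpoly set) i j"
proof -
  have "tensor_cycles F i j \<noteq> tensor_boundaries F i j \<longleftrightarrow> koszul_Tor (sqf_ideal G :: ('v, 'k) mpoly set) i j"
    if "graded_free_resolution F (sqf_ideal G)" for F :: "('v, 'k) free_complex"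
  proof -
    interpret resolved_ideal F "sqf_ideal G" by unfold_locales (use that assms in \<open>auto simp: sqf_ideal_const\<close>)
    show ?thesis by (rule tensor_homology_iff_koszul_Tor)
  qed
  then show ?thesis unfolding Tor_nonzero_def using taylor_resolution[of G] by blast
qed

text \<open>Read off from the Taylor resolution: a position counts generators in a cell, and a shift
  is the degree of a squarefree lcm, at most the number of variables.\<close>

lemma finite_Tor_nonzero:
  assumes "{} \<notin> G"
  shows "finite {j - int i | i j. Tor_nonzero (sqf_ideal G :: ('v::finite, 'k::field) mpoly set) i j}"
proof -
  let ?M = "sqf_ideal G :: ('v, 'k) mpoly set"
  let ?T = "taylor G :: ('v, 'k) free_complex"
  interpret resolved_ideal ?T ?M
    by unfold_locales (auto simp: taylor_resolution sqf_ideal_const[OF assms])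
  have "i < card (UNIV :: 'v set set) \<and> j \<in> {0..int (card (UNIV :: 'v set))}" if "Tor_nonzero ?M i j" for i j
  proof -
    have "tensor_cycles ?T i j \<noteq> tensor_boundaries ?T i j"
      using that assms by (simp add: tensor_homology_iff_koszul_Tor Tor_nonzero_iff_koszul_Tor)
    then obtain x where x: "x \<in> tensor_cycles ?T i j" "x \<notin> tensor_boundaries ?T i j"
      using tensor_boundaries_subset by blast
    \<comment> \<open>As zero is a boundary, \<open>x\<close> has a nonzero entry, which names a
      basis element of degree \<open>j\<close> in position \<open>i\<close>.\<close>
    have "(\<lambda>_. 0) \<in> tensor_boundaries ?T i j"
      unfolding tensor_boundaries_def
      by (rule image_eqI[of _ _ "\<lambda>_. 0"]) (auto simp: tensor_differential_def tensor_K_def)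
    then obtain b where b: "x b \<noteq> 0" using x(2) by (metis ext)
    have "x \<in> tensor_K ?T i j" using x(1) by (auto simp: tensor_cycles_def split: nat.splits)
    then have b': "b < rk ?T i" "shift ?T i b = j" using b by (auto simp: tensor_K_def)
    then have "cell_enum G i b \<in> cells G i" by (intro cell_enum_in) (simp add: taylor_def)
    then have "card (cell_enum G i b) = Suc i" by (simp add: cells_def)
    moreover have "card (cell_enum G i b) \<le> card (UNIV :: 'v set set)" by (rule card_mono) auto
    moreover have "card (\<Union>(cell_enum G i b)) \<le> card (UNIV :: 'v set)" by (rule card_mono) auto
    ultimately show ?thesis using b' by (auto simp: taylor_def)
  qed
  then have "{j - int i | i j. Tor_nonzero ?M i j} \<subseteq>
      (\<lambda>(i, j). j - int i) ` ({..<card (UNIV :: 'v set set)} \<times> {0..int (card (UNIV :: 'v set))})"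
    by force
  then show ?thesis by (rule finite_subset) simp
qed

subsection \<open>Gap free graphs\<close>

definition path3s :: "'v set set \<Rightarrow> 'v set set" where
  "path3s E = {{a, b, c} | a b c. a \<noteq> b \<and> b \<noteq> c \<and> a \<noteq> c \<and> {a, b} \<in> E \<and> {b, c} \<in> E}"

lemma simple_graph_edge:
  assumes "simple_graph E" "e \<in> E"
  obtains x y where "e = {x, y}" "x \<noteq> y"
  using assms unfolding simple_graph_def by (meson card_2_iff)

lemma edge_ideal_eq:
  assumes "simple_graph E"
  shows "edge_ideal E = (sqf_ideal E :: ('v::finite, 'k::field) mpoly set)"
proof -
  have "{Var x * Var y | x y. {x, y} \<in> E} = (sqmono ` E :: ('v, 'k) mpoly set)"
  proof (intro equalityI subsetI)
    fix p :: "('v, 'k) mpoly"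
    assume "p \<in> {Var x * Var y | x y. {x, y} \<in> E}"
    then obtain x y where xy: "p = Var x * Var y" "{x, y} \<in> E" by blast
    then have "card {x, y} = 2" using assms by (simp add: simple_graph_def)
    then have "x \<noteq> y" by auto
    then have "p = sqmono {x, y}" using sqmono_mult[of "{x}" "{y}"] xy by (simp add: Var_eq_sqmono insert_commute)
    then show "p \<in> sqmono ` E" using xy(2) by (rule image_eqI)
  next
    fix p :: "('v, 'k) mpoly"
    assume "p \<in> sqmono ` E"
    then obtain e where e: "p = sqmono e" "e \<in> E" by blast
    then obtain x y where xy: "e = {x, y}" "x \<noteq> y" using simple_graph_edge[OF assms e(2)] by metis
    then have "p = Var x * Var y" using sqmono_mult[of "{x}" "{y}", where 'b = 'k] e by (simp add: Var_eq_sqmono insert_commute)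
    then show "p \<in> {Var x * Var y | x y. {x, y} \<in> E}"
      using e(2) unfolding xy(1) by (intro CollectI exI[of _ x] exI[of _ y] conjI)
  qed
  then show ?thesis by (simp only: edge_ideal_def ideal_gen_sqmono)
qed

lemma path3_ideal_eq: "path3_ideal E = (sqf_ideal (path3s E) :: ('v::finite, 'k::field) mpoly set)"
proof -
  have V: "Var a * Var b * Var c = (sqmono {a, b, c} :: ('v, 'k) mpoly)" if "a \<noteq> b" "b \<noteq> c" "a \<noteq> c" for a b c :: 'v
    using sqmono_mult[of "{a}" "{b}", where 'b = 'k] sqmono_mult[of "{a, b}" "{c}", where 'b = 'k] that
    by (simp add: Var_eq_sqmono insert_commute)
  have "{Var a * Var b * Var c | a b c. a \<noteq> b \<and> b \<noteq> c \<and> a \<noteq> c \<and> {a, b} \<in> E \<and> {b, c} \<in> E} =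
      (sqmono ` path3s E :: ('v, 'k) mpoly set)"
  proof (intro equalityI subsetI)
    fix p :: "('v, 'k) mpoly"
    assume "p \<in> {Var a * Var b * Var c | a b c. a \<noteq> b \<and> b \<noteq> c \<and> a \<noteq> c \<and> {a, b} \<in> E \<and> {b, c} \<in> E}"
    then obtain a b c where "p = Var a * Var b * Var c" "a \<noteq> b" "b \<noteq> c" "a \<noteq> c" "{a, b} \<in> E" "{b, c} \<in> E" by blast
    moreover from this have "{a, b, c} \<in> path3s E"
      unfolding path3s_def by (intro CollectI exI[of _ a] exI[of _ b] exI[of _ c]) simp
    ultimately show "p \<in> sqmono ` path3s E" using V[of a b c] by simp
  next
    fix p :: "('v, 'k) mpoly"
    assume "p \<in> sqmono ` path3s E"
    then obtain a b c where "p = sqmono {a, b, c}" "a \<noteq> b" "b \<noteq> c" "a \<noteq> c" "{a, b} \<in> E" "{b, c} \<in> E"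
      unfolding path3s_def by blast
    then show "p \<in> {Var a * Var b * Var c | a b c. a \<noteq> b \<and> b \<noteq> c \<and> a \<noteq> c \<and> {a, b} \<in> E \<and> {b, c} \<in> E}"
      using V[of a b c] by (intro CollectI exI[of _ a] exI[of _ b] exI[of _ c]) simp
  qed
  then show ?thesis by (simp only: path3_ideal_def ideal_gen_sqmono)
qed

lemma card_path3s: "p \<in> path3s E \<Longrightarrow> card p = 3"
  by (auto simp: path3s_def)

text \<open>Edges that share a vertex form a path; for disjoint ones gap freeness gives a connecting
  edge. The path found contains all of \<open>e\<close> and a single further vertex of
  \<open>e'\<close>, which is sharper than membership in the path ideal and is what the exchange
  property requires.\<close>

lemma gap_free_path3:
  assumes E: "simple_graph E" and gf: "gap_free E" and e: "e \<in> E" "e' \<in> E" "e \<noteq> e'"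
  shows "\<exists>z\<in>e' - e. insert z e \<in> path3s E"
proof -
  have P: "\<exists>z\<in>e' - e. insert z e \<in> path3s E" if p: "p \<in> e" "q \<in> e'" "q \<notin> e" "{p, q} \<in> E" for p q
  proof -
    obtain x y where "e = {x, y}" "x \<noteq> y" by (rule simple_graph_edge[OF E e(1)])
    then obtain a where a: "e = {p, a}" "a \<noteq> p" using p(1) by blast
    have "insert q e \<in> path3s E"
      unfolding path3s_def
    proof (rule CollectI, rule exI[of _ q], rule exI[of _ p], rule exI[of _ a], intro conjI)
      show "{q, p} \<in> E" using p(4) by (simp add: insert_commute)
      show "{p, a} \<in> E" using e(1) a(1) by simp
      show "q \<noteq> p" "p \<noteq> a" "q \<noteq> a" using p(3) a by auto
      show "insert q e = {q, p, a}" using a(1) by simp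
    qed
    then show ?thesis using p by blast
  qed
  obtain a b where ab: "e = {a, b}" "a \<noteq> b" by (rule simple_graph_edge[OF E e(1)])
  obtain x y where xy: "e' = {x, y}" "x \<noteq> y" by (rule simple_graph_edge[OF E e(2)])
  show ?thesis
  proof (cases "e \<inter> e' = {}")
    case True
    have "\<exists>p\<in>e. \<exists>q\<in>e'. {p, q} \<in> E"
    proof (rule ccontr)
      assume "\<not> ?thesis"
      then have "\<forall>p\<in>{a, b}. \<forall>q\<in>{x, y}. {p, q} \<notin> E" unfolding ab(1) xy(1) by blast
      moreover have "{a, b} \<in> E" "{x, y} \<in> E" "{a, b} \<inter> {x, y} = {}"
        using e True unfolding ab(1) xy(1) by simp_all
      ultimately show False using gf unfolding gap_free_def by metis
    qed
    then obtain p q where pq: "p \<in> e" "q \<in> e'" "{p, q} \<in> E" by blast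
    moreover have "q \<notin> e" using pq(2) True by blast
    ultimately show ?thesis by (intro P)
  next
    case False
    then consider "x \<in> e" "y \<notin> e" | "y \<in> e" "x \<notin> e"
      using e(3) ab xy by auto
    then show ?thesis
    proof cases
      case 1
      then show ?thesis using P[of x y] e xy by simp
    next
      case 2
      then show ?thesis using P[of y x] e xy by (simp add: insert_commute)
    qed
  qed
qed

text \<open>Outside the path ideal only one edge fits into a support. Thus the edges found in
  \<open>insert u W\<close> and \<open>insert v W\<close> coincide and lie in \<open>W\<close>;
  conversely, a path in \<open>insert u (insert v W)\<close> can be replaced by one that avoids
  \<open>u\<close> or \<open>v\<close>.\<close>

lemma path3_edge_exchange:
  fixes E :: "'v::finite set set"
  defines "A \<equiv> \<lambda>S. \<exists>e\<in>E. e \<subseteq> S" and "B \<equiv> \<lambda>S. \<exists>p\<in>path3s E. p \<subseteq> S"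
  assumes E: "simple_graph E" and gf: "gap_free E"
    and uv: "u \<noteq> v" and Av: "A (insert v W)" and Bv: "\<not> B (insert v W)"
  shows "A (insert u W) \<and> \<not> B (insert u (insert v W)) \<longleftrightarrow> A W \<and> \<not> B (insert u W)"
proof -
  have BI: "B S" if "p \<in> path3s E" "p \<subseteq> S" for p S
    using that unfolding B_def by (rule bexI[rotated])
  have AI: "A S" if "e \<in> E" "e \<subseteq> S" for e S
    using that unfolding A_def by (rule bexI[rotated])
  have B_mono: "B T" if "B S" "S \<subseteq> T" for S T
    using that unfolding B_def by (meson order_trans)
  have A_mono: "A T" if "A S" "S \<subseteq> T" for S T
    using that unfolding A_def by (meson order_trans)
  show ?thesis
  proof
    assume L: "A (insert u W) \<and> \<not> B (insert u (insert v W))"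
    then obtain e where e: "e \<in> E" "e \<subseteq> insert u W" unfolding A_def by blast
    obtain e' where e': "e' \<in> E" "e' \<subseteq> insert v W" using Av unfolding A_def by blast
    have "e = e'"
    proof (rule ccontr)
      assume "e \<noteq> e'"
      then obtain z where z: "z \<in> e' - e" "insert z e \<in> path3s E"
        using gap_free_path3[OF E gf e(1) e'(1)] by blast
      have "insert z e \<subseteq> insert u (insert v W)" using z(1) e(2) e'(2) by blast
      then show False using L BI[OF z(2)] by simp
    qed
    then have "e \<subseteq> W" using e(2) e'(2) uv by blast
    then show "A W \<and> \<not> B (insert u W)"
      using AI[OF e(1)] L B_mono[of "insert u W" "insert u (insert v W)"] by blast
  next
    assume R: "A W \<and> \<not> B (insert u W)"
    then obtain e where e: "e \<in> E" "e \<subseteq> W" unfolding A_def by blast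
    have "\<not> B (insert u (insert v W))"
    proof
      assume "B (insert u (insert v W))"
      then obtain p where "p \<in> path3s E" and pW: "p \<subseteq> insert u (insert v W)"
        unfolding B_def by blast
      then obtain a b c where p: "p = {a, b, c}" "a \<noteq> c" "a \<noteq> b" "{a, b} \<in> E" "{b, c} \<in> E"
        unfolding path3s_def by blast
      have "{a, b} \<noteq> {b, c}" using p(2,3) by (auto simp: doubleton_eq_iff)
      then have "e \<noteq> {a, b} \<or> e \<noteq> {b, c}" by simp
      then obtain e' where e': "e' \<in> E" "e \<noteq> e'" "e' \<subseteq> p"
        using p(4,5) unfolding p(1) by (metis insertCI insert_subset empty_subsetI)
      obtain z where z: "z \<in> e' - e" "insert z e \<in> path3s E"
        using gap_free_path3[OF E gf e(1) e'(1,2)] by blast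
      have "z \<in> insert u (insert v W)" using z(1) e'(3) pW by blast
      \<comment> \<open>As \<open>e\<close> already lies in \<open>W\<close>, the new path uses at
        most one of \<open>u\<close> and \<open>v\<close>, and either case is excluded by
        assumption.\<close>
      then have "insert z e \<subseteq> insert u W \<or> insert z e \<subseteq> insert v W" using e(2) by blast
      then show False using R Bv BI[OF z(2)] by blast
    qed
    then show "A (insert u W) \<and> \<not> B (insert u (insert v W))"
      using R A_mono[OF _ subset_insertI] by blast
  qed
qed

text \<open>If the class died over I, some \<open>h\<close> over I would have the boundary of
  \<open>g\<close> and be a cycle modulo I_3 in position i + 1. Up to boundaries such cycles have
  coefficients of degree 2, hence total degree i + 3; in every other degree \<open>h\<close> can be
  moved into I_3.\<close>

lemma koszul_Tor_path3:
  fixes E :: "'v::finite set set"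
  assumes E: "simple_graph E" and gf: "gap_free E"
    and T: "koszul_Tor (sqf_ideal (path3s E) :: ('v, 'k::field) mpoly set) i j" and j: "j \<noteq> int i + 3"
  shows "koszul_Tor (sqf_ideal E :: ('v, 'k) mpoly set) i j"
proof -
  let ?I = "sqf_ideal E :: ('v, 'k) mpoly set" and ?J = "sqf_ideal (path3s E) :: ('v, 'k) mpoly set"
  define A where "A = (\<lambda>S. \<exists>e\<in>E. e \<subseteq> S)"
  define B where "B = (\<lambda>S. \<exists>p\<in>path3s E. p \<subseteq> S)"
  have I_iff: "p \<in> ?I \<longleftrightarrow> (\<forall>m\<in>keys p. A (keys m))" for p
    by (simp add: sqf_ideal_def A_def)
  have J_iff: "p \<in> ?J \<longleftrightarrow> (\<forall>m\<in>keys p. B (keys m))" for p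
    by (simp add: sqf_ideal_def B_def)
  have BA: "A S" if "B S" for S
  proof -
    obtain a b c where "{a, b, c} \<subseteq> S" "{a, b} \<in> E"
      using \<open>B S\<close> unfolding path3s_def B_def by auto
    then show ?thesis unfolding A_def by (intro bexI[of _ "{a, b}"]) auto
  qed
  have A_mono: "A T" if "S \<subseteq> T" "A S" for S T
    using that unfolding A_def by (meson order_trans)
  have B_mono: "B T" if "S \<subseteq> T" "B S" for S T
    using that unfolding B_def by (meson order_trans)
  have exch: "A (insert u W) \<and> \<not> B (insert u (insert v W)) \<longleftrightarrow> A W \<and> \<not> B (insert u W)"
    if "u \<noteq> v" "A (insert v W)" "\<not> B (insert v W)" for u v W
    using that(2,3) unfolding A_def B_def by (rule path3_edge_exchange[OF E gf that(1)])
  have JI: "p \<in> ?J \<Longrightarrow> p \<in> ?I" for p unfolding I_iff J_iff using BA by simp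
  obtain g where gT: "(\<forall>s. card s \<noteq> Suc i \<longrightarrow> g s = 0) \<and> (\<forall>s. homogeneous (j - int (Suc i)) (g s)) \<and>
        (\<forall>s. koszul g s \<in> ?J) \<and> \<not> (\<exists>h. (\<forall>s. h s \<in> ?J) \<and> koszul h = koszul g)"
    using T unfolding koszul_Tor_def ..
  then have g: "\<And>s. card s \<noteq> Suc i \<Longrightarrow> g s = 0" "\<And>s. homogeneous (j - int (Suc i)) (g s)"
    "\<And>s. koszul g s \<in> ?J" and n: "\<not> (\<exists>h. (\<forall>s. h s \<in> ?J) \<and> koszul h = koszul g)"
    by simp_all
  \<comment> \<open>Position \<open>Suc i\<close> and total degree \<open>j\<close>, the bidegree of
    \<open>g\<close>.\<close>
  let ?pr = "\<lambda>f s. if card s = Suc i then hcomp (j - int (Suc i)) (f s) else 0"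
  have "\<not> (\<exists>h. (\<forall>s. h s \<in> ?I) \<and> koszul h = koszul g)"
  proof
    assume "\<exists>h. (\<forall>s. h s \<in> ?I) \<and> koszul h = koszul g"
    then obtain h where "(\<forall>s. h s \<in> ?I) \<and> koszul h = koszul g" ..
    then have h: "\<And>s. h s \<in> ?I" "koszul h = koszul g" by simp_all
    have hA: "\<And>s m. m \<in> keys (h s) \<Longrightarrow> A (keys m)" using h(1) unfolding I_iff by simp
    have hB: "\<And>s m. m \<in> keys (koszul h s) \<Longrightarrow> B (keys m)" using g(3) unfolding h(2) J_iff by simp
    have "\<exists>u. (\<forall>s. \<forall>m\<in>keys (u s). A (keys m)) \<and>
     (\<forall>s. \<forall>m\<in>keys (h s - koszul u s). B (keys m) \<or>
        A (keys m) \<and> \<not> B (keys m) \<and> (\<forall>v\<in>s. B (insert v (keys m))) \<and>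
        (\<forall>v\<in>keys m - s. \<not> A (keys (m - indm {v}))))"
      by (rule koszul_quotient[where A = A and B = B and f = h, OF A_mono B_mono exch hA hB])
    then obtain u where "(\<forall>s. \<forall>m\<in>keys (u s). A (keys m)) \<and>
     (\<forall>s. \<forall>m\<in>keys (h s - koszul u s). B (keys m) \<or>
        A (keys m) \<and> \<not> B (keys m) \<and> (\<forall>v\<in>s. B (insert v (keys m))) \<and>
        (\<forall>v\<in>keys m - s. \<not> A (keys (m - indm {v}))))" ..
    then have u: "\<And>s m. m \<in> keys (h s - koszul u s) \<Longrightarrow> B (keys m) \<or>
        A (keys m) \<and> \<not> B (keys m) \<and> (\<forall>v\<in>s. B (insert v (keys m))) \<and>
        (\<forall>v\<in>keys m - s. \<not> A (keys (m - indm {v})))" by simp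
    define h' where "h' s = h s - koszul u s" for s
    have deg: "total_deg m = 2" if m: "m \<in> keys (h' s)" "\<not> B (keys m)" for m s
    proof -
      have k: "A (keys m)" "\<forall>v\<in>s. B (insert v (keys m))" "\<forall>v\<in>keys m - s. \<not> A (keys (m - indm {v}))"
        using u[of m s] m unfolding h'_def by simp_all
      \<comment> \<open>A variable of \<open>m\<close> inside the cell would give
        \<open>B (keys m)\<close> by the second condition, so no variable at all can be divided out
        of \<open>m\<close> within I.\<close>
      have "v \<notin> s" if "v \<in> keys m" for v
        using k(2) m(2) that by (metis insert_absorb)
      then have min: "\<not> A (keys (m - indm {v}))" if "v \<in> keys m" for v using k(3) that by blast
      obtain e where e: "e \<in> E" "e \<subseteq> keys m" using k(1) unfolding A_def by blast
      have "lookup m v = lookup (indm e) v" for v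
      proof (rule ccontr)
        assume ne: "lookup m v \<noteq> lookup (indm e) v"
        have "v \<in> keys m"
        proof (rule ccontr)
          assume v: "v \<notin> keys m"
          then have "v \<notin> e" using e by blast
          then show False using v ne by (simp add: in_keys_iff lookup_indm)
        qed
        \<comment> \<open>Any surplus exponent, at a vertex of \<open>e\<close> or elsewhere, could
          be lowered by one with \<open>e\<close> still dividing. Minimality therefore forces
          \<open>m\<close> to be the edge monomial itself.\<close>
        moreover have "e \<subseteq> keys (m - indm {v})"
        proof
          fix w assume w: "w \<in> e"
          then have "lookup m w \<noteq> 0" using e by (auto simp: in_keys_iff)
          then show "w \<in> keys (m - indm {v})"
            using ne w by (cases "w = v") (auto simp: in_keys_iff lookup_minus lookup_indm)
        qed
        ultimately show False using min e(1) unfolding A_def by blast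
      qed
      then have "m = indm e" by (rule poly_mapping_eqI)
      then show ?thesis using e E by (simp add: simple_graph_def)
    qed
    have "?pr h' s \<in> ?J" for s
    proof -
      have "B (keys m)" if "m \<in> keys (hcomp (j - int (Suc i)) (h' s))" for m
      proof (rule ccontr)
        assume "\<not> B (keys m)"
        moreover have "m \<in> keys (h' s)" "int (total_deg m) = j - int (Suc i)"
          using that by (auto simp: hcomp_def keys_filt)
        \<comment> \<open>A coefficient of degree 2 would mean \<open>j - int (Suc i) = 2\<close>,
          the excluded degree.\<close>
        ultimately show False using deg[of m s] j by simp
      qed
      then show ?thesis by (simp add: J_iff)
    qed
    moreover have "koszul (?pr h') = koszul g"
    proof
      fix t
      have h't: "koszul h' t = koszul g t"
      proof -
        have "h' = (\<lambda>s. h s - koszul u s)" by (simp add: h'_def fun_eq_iff)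
        then show ?thesis using koszul_diff[of h "koszul u" t] h(2) by (simp add: koszul_koszul)
      qed
      have "g = ?pr g" using g(1,2) by (auto simp: homogeneous_iff_hcomp)
      then have "koszul (?pr g) t = koszul g t" by (rule arg_cong[where f = "\<lambda>x. koszul x t", symmetric])
      moreover have "koszul (?pr h') t = koszul (?pr g) t" by (simp only: koszul_hcomp h't)
      ultimately show "koszul (?pr h') t = koszul g t" by (rule trans[rotated])
    qed
    ultimately have "\<exists>h. (\<forall>s. h s \<in> ?J) \<and> koszul h = koszul g"
      by (intro exI[of _ "?pr h'"] conjI allI)
    then show False using n by contradiction
  qed
  then show ?thesis
    unfolding koszul_Tor_def using gT JI by (intro exI[of _ g]) simp
qed

text \<open>A path monomial is a minimal generator: after removing one variable, too few remain to
  contain another path. It yields a class in position 0 and degree 3, so the set whose maximum is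
  the regularity of I_3 is nonempty.\<close>

lemma koszul_Tor_path3_generator:
  assumes P: "path3s (E :: 'v::finite set set) \<noteq> {}"
  shows "koszul_Tor (sqf_ideal (path3s E) :: ('v, 'k::field) mpoly set) 0 3"
proof -
  let ?J = "sqf_ideal (path3s E) :: ('v, 'k) mpoly set"
  obtain p where p: "p \<in> path3s E" using P by blast
  then obtain c where c: "c \<in> p" using card_path3s by fastforce
  define q where "q = p - {c}"
  have q: "card q = 2" "p = insert c q" "c \<notin> q" using c card_path3s[OF p] by (auto simp: q_def)
  define g :: "'v set \<Rightarrow> ('v, 'k) mpoly" where "g s = (if s = {c} then sqmono q else 0)" for s
  have g0: "koszul g {} = sqmono p"
  proof -
    have "koszul g {} = (\<Sum>v\<in>UNIV. if v = c then Var c * sqmono q else 0)"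
      unfolding koszul_eq by (rule sum.cong) (auto simp: g_def sg_def)
    also have "\<dots> = sqmono p" using sqmono_mult[of "{c}" q, where 'b = 'k] q by (simp add: Var_eq_sqmono)
    finally show ?thesis .
  qed
  have g1: "koszul g t = 0" if "t \<noteq> {}" for t
    unfolding koszul_eq by (rule sum.neutral) (use that in \<open>auto simp: g_def\<close>)
  have "\<not> (\<exists>h. (\<forall>s. h s \<in> ?J) \<and> koszul h = koszul g)"
  proof
    assume "\<exists>h. (\<forall>s. h s \<in> ?J) \<and> koszul h = koszul g"
    then obtain h where h: "\<And>s. h s \<in> ?J" "koszul h = koszul g" by blast
    have z: "lookup (Var v * h {v}) (indm p) = 0" for v
    proof (cases "v \<in> p")
      case True
      have "indm p - indm {v} \<notin> keys (h {v})"
      proof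
        assume k: "indm p - indm {v} \<in> keys (h {v})"
        obtain p' where p': "p' \<in> path3s E" "p' \<subseteq> keys (indm p - indm {v})"
          using h(1)[of "{v}"] k by (auto simp: sqf_ideal_def)
        have "keys (indm p - indm {v}) \<subseteq> p - {v}"
          by (auto simp: in_keys_iff lookup_minus lookup_indm split: if_splits)
        then have "p' \<subseteq> p - {v}" using p' by blast
        then have "card p' \<le> card (p - {v})" by (intro card_mono) auto
        then show False using card_path3s[OF p] card_path3s[OF p'(1)] True by simp
      qed
      then show ?thesis by (simp add: Var_eq_sqmono lookup_sqmono_mult in_keys_iff)
    qed (simp add: Var_eq_sqmono lookup_sqmono_mult)
    have "koszul h {} = (\<Sum>v\<in>UNIV. Var v * h {v})"
      by (simp add: koszul_eq sg_def)
    then have "lookup (koszul h {}) (indm p) = 0" by (simp add: lookup_sum z)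
    then show False using h(2) g0 by (simp add: sqmono_def)
  qed
  moreover have "homogeneous (3 - int (Suc 0)) (g s)" for s
    using homogeneous_sqmono[of q, where 'k = 'k] q(1) by (simp add: g_def homogeneous_iff_hcomp)
  moreover have "koszul g s \<in> ?J" for s
    using g0 g1[of s] sqmono_in_sqf_ideal[OF p subset_refl] by (cases "s = {}") (simp_all add: sqf_ideal_zero)
  ultimately show ?thesis
    unfolding koszul_Tor_def by (intro exI[of _ g]) (auto simp: g_def)
qed

theorem theorem3p2:
  fixes E :: "'v::finite set set"
    and I I3 :: "('v, 'k::field) mpoly set"
    and r :: int
  assumes "simple_graph E"
    and "gap_free E"
    and "I = edge_ideal E"
    and "I3 = path3_ideal E"
    and "I3 \<noteq> {0}"
    and "regularity I = r"
  shows "regularity I3 \<le> max r 3"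
proof -
  let ?T = "\<lambda>M :: ('v, 'k) mpoly set. {j - int i | i j. Tor_nonzero M i j}"
  have I: "I = sqf_ideal E" using assms edge_ideal_eq by simp
  have J: "I3 = sqf_ideal (path3s E)" using assms path3_ideal_eq by simp
  have nE: "{} \<notin> E" using assms(1) by (auto simp: simple_graph_def)
  have nP: "{} \<notin> path3s E" by (auto simp: path3s_def)
  have "path3s E \<noteq> {}"
  proof
    assume "path3s E = {}"
    then have "I3 = {0}" by (auto simp: J sqf_ideal_def)
    then show False using assms(5) by simp
  qed
  then have "Tor_nonzero I3 0 3"
    unfolding J by (simp add: Tor_nonzero_iff_koszul_Tor[OF nP] koszul_Tor_path3_generator)
  then have ne: "?T I3 \<noteq> {}" by blast
  have fin: "finite (?T I3)" "finite (?T I)"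
    using finite_Tor_nonzero[OF nP] finite_Tor_nonzero[OF nE] by (simp_all add: I J)
  \<comment> \<open>Classes with \<open>j = int i + 3\<close> contribute exactly 3; all others also
    occur for I and are bounded by \<open>r\<close>.\<close>
  have "j - int i \<le> max r 3" if "Tor_nonzero I3 i j" for i j
  proof (cases "j = int i + 3")
    case False
    have "koszul_Tor I i j"
      using koszul_Tor_path3[OF assms(1,2) _ False] that
      by (simp add: I J Tor_nonzero_iff_koszul_Tor[OF nP])
    then have "Tor_nonzero I i j" by (simp add: I Tor_nonzero_iff_koszul_Tor[OF nE])
    then have "j - int i \<in> ?T I" by blast
    then have "j - int i \<le> Max (?T I)" using fin(2) by (rule Max_ge[rotated])
    then show ?thesis using assms(6) by (simp add: regularity_def)
  qed simp
  then have "\<forall>x\<in>?T I3. x \<le> max r 3" by blast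
  then show ?thesis
    unfolding regularity_def by (subst Max_le_iff[OF fin(1) ne])
qed

end
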